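(* The dimensions of the linear spans $\langle\mathrm{hMPS}(2,2,d)\rangle\subseteq(\mathbb{C}^2)^{\otimes d}$ of the varieties of homogeneous matrix product states satisfy $$\sum_{d\in\mathbb{N}}\dim\langle\mathrm{hMPS}(2,2,d)\rangle\,t^d = H(\mathcal{M}_{2,2};t,t)=\frac{1-2t+t^2+2t^3-t^4}{(1-t)^4(1-t^2)},$$ a power series beginning with $1+2t+4t^2+8t^3+16t^4+30t^5+53t^6+88t^7+139t^8+210t^9+306t^{10}+432t^{11}+594t^{12}+798t^{13}+1051t^{14}+1360t^{15}+\cdots$. Equivalently, for every $d\in\mathbb{N}$, $$\dim\langle\mathrm{hMPS}(2,2,d)\rangle=\begin{cases}\frac{1}{48}(d^4+4d^3+2d^2+44d+48)&\text{if } d \text{ is even},\\[2pt] \frac{1}{48}(d^4+4d^3+2d^2+44d+45)&\text{if } d \text{ is odd}.\end{cases}$$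
   Context: We work over $\mathbb{C}$, and $\mathbb{N}$ includes $0$. Homogeneous matrix product states: let $e_1,\ldots,e_n$ be the standard basis of $\mathbb{C}^n$. The variety $\mathrm{hMPS}(m,n,d)\subseteq(\mathbb{C}^n)^{\otimes d}$ is the closure of the image of the map $$(\mathbb{C}^{m\times m})^{n+1}\to(\mathbb{C}^n)^{\otimes d},\qquad (X,A_1,\ldots,A_n)\mapsto\sum_{1\le i_1,\ldots,i_d\le n}\operatorname{Tr}(XA_{i_1}\cdots A_{i_d})\,e_{i_1}\otimes\cdots\otimes e_{i_d}.$$ (For $d=0$ the tensor space is $\mathbb{C}$ and the empty product is the identity matrix.) The notation $\langle\cdot\rangle$ denotes linear span. Here $m=n=2$. Ring of generic matrices: let $\mathbb{C}\langle x_1,\ldots,x_n\rangle$ be the noncommutative polynomial ring (free associative unital algebra) in $n$ variables. An element $f$ is a polynomial identity for $m\times m$ matrices if it vanishes when $x_1,\ldots,x_n$ are substituted by generic $m\times m$ matrices (matrices whose $nm^2$ entries are independent commuting variables). The ring $\mathcal{M}_{m,n}$ is the quotient of $\mathbb{C}\langle x_1,\ldots,x_n\rangle$ by the ideal of polynomial identities for $m\times m$ matrices, with the inherited $\mathbb{N}^n$-grading in which $x_i$ has degree the $i$-th standard basis vector. Hilbert series: for an $\mathbb{N}^n$-graded vector space $R$, $H(R;t_1,\ldots,t_n)=\sum_{(d_1,\ldots,d_n)\in\mathbb{N}^n}\dim R_{(d_1,\ldots,d_n)}\,t_1^{d_1}\cdots t_n^{d_n}$. *)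

theory Defs
  imports
    "HOL-Analysis.Analysis"
    "HOL-Library.Poly_Mapping"
    "HOL-Library.Numeral_Type"
    "HOL-Library.Function_Algebras"
    "HOL-Computational_Algebra.Formal_Power_Series"
begin

text \<open>
  A finite type \<open>'n\<close> indexes the variables \<open>x_1,\<dots>,x_n\<close> (and the basis \<open>e_1,\<dots>,e_n\<close>),
  a finite type \<open>'m\<close> indexes the rows and columns of the matrices.
\<close>

primrec word_prod :: "('n \<Rightarrow> 'r::semiring_1^'m^'m) \<Rightarrow> 'n list \<Rightarrow> 'r^'m^'m" where
  "word_prod A [] = mat 1"
| "word_prod A (i # w) = A i ** word_prod A w"

type_synonym 'v mpoly = "('v \<Rightarrow>\<^sub>0 nat) \<Rightarrow>\<^sub>0 complex"

definition mpoly_const :: "complex \<Rightarrow> 'v mpoly" where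
  "mpoly_const c = Poly_Mapping.single 0 c"

definition mpoly_var :: "'v \<Rightarrow> 'v mpoly" where
  "mpoly_var v = Poly_Mapping.single (Poly_Mapping.single v 1) 1"

definition mpoly_eval :: "'v mpoly \<Rightarrow> ('v \<Rightarrow> complex) \<Rightarrow> complex" where
  "mpoly_eval p x =
     (\<Sum>\<mu>\<in>Poly_Mapping.keys p. Poly_Mapping.lookup p \<mu> *
        (\<Prod>v\<in>Poly_Mapping.keys \<mu>. x v ^ Poly_Mapping.lookup \<mu> v))"


section \<open>Homogeneous matrix product states\<close>

text \<open>
  A tensor in \<open>(\<complex>\<^sup>n)\<^sup>\<otimes>\<^sup>d\<close> is given by its coefficients with respect to the basis
  \<open>e_w = e_{i_1} \<otimes> \<cdots> \<otimes> e_{i_d}\<close>, where \<open>w\<close> runs through the words of length \<open>d\<close>; all coefficients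
  at words of another length are \<open>0\<close>, so that the spaces for all \<open>d\<close> live in one type.
\<close>

definition tensor_space :: "nat \<Rightarrow> ('n list \<Rightarrow> complex) set" where
  "tensor_space d = {T. \<forall>w. length w \<noteq> d \<longrightarrow> T w = 0}"

definition tensor_scale :: "complex \<Rightarrow> ('n list \<Rightarrow> complex) \<Rightarrow> 'n list \<Rightarrow> complex" where
  "tensor_scale c T = (\<lambda>w. c * T w)"

interpretation tensor: vector_space tensor_scale
  by unfold_locales (auto simp: tensor_scale_def algebra_simps fun_eq_iff)

definition hmps_map ::
    "nat \<Rightarrow> complex^'m^'m \<Rightarrow> ('n \<Rightarrow> complex^'m^'m) \<Rightarrow> 'n list \<Rightarrow> complex" where
  "hmps_map d X A = (\<lambda>w. if length w = d then trace (X ** word_prod A w) else 0)"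

text \<open>Polynomials on the tensor space are polynomials in the coefficients of a tensor.\<close>

definition zariski_closure ::
    "('v \<Rightarrow> complex) set \<Rightarrow> ('v \<Rightarrow> complex) set \<Rightarrow> ('v \<Rightarrow> complex) set" where
  "zariski_closure V S =
     {T \<in> V. \<forall>p. (\<forall>U\<in>S. mpoly_eval p U = 0) \<longrightarrow> mpoly_eval p T = 0}"

definition hMPS ::
    "'m::finite itself \<Rightarrow> 'n::finite itself \<Rightarrow> nat \<Rightarrow> ('n list \<Rightarrow> complex) set" where
  "hMPS _ _ d = zariski_closure (tensor_space d)
     {hmps_map d X A | (X :: complex^'m^'m) (A :: 'n \<Rightarrow> complex^'m^'m). True}"

lemma hmps_map_in_tensor_space: "hmps_map d X A \<in> tensor_space d"
  by (simp add: hmps_map_def tensor_space_def)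

definition dim_span_hMPS :: "'m::finite itself \<Rightarrow> 'n::finite itself \<Rightarrow> nat \<Rightarrow> nat" where
  "dim_span_hMPS M N d = tensor.dim (tensor.span (hMPS M N d))"


section \<open>The ring of generic matrices\<close>

text \<open>
  With concatenation as addition on words, the convolution product of \<open>'n list \<Rightarrow>\<^sub>0 complex\<close>
  is the product of the free algebra.
\<close>

instantiation list :: (type) monoid_add
begin

definition zero_list :: "'a list" where "zero_list = []"
definition plus_list :: "'a list \<Rightarrow> 'a list \<Rightarrow> 'a list" where "plus_list = (@)"

instance by standard (simp_all add: zero_list_def plus_list_def)

end

type_synonym 'n free_algebra = "'n list \<Rightarrow>\<^sub>0 complex"

definition generic_matrix :: "'n \<Rightarrow> ('n \<times> 'm \<times> 'm) mpoly^'m^'m" where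
  "generic_matrix i = (\<chi> j k. mpoly_var (i, j, k))"

definition subst_matrices ::
    "('n \<Rightarrow> 'v mpoly^'m^'m) \<Rightarrow> 'n free_algebra \<Rightarrow> 'v mpoly^'m^'m" where
  "subst_matrices A f =
     (\<Sum>w\<in>Poly_Mapping.keys f. mat (mpoly_const (Poly_Mapping.lookup f w)) ** word_prod A w)"

definition polynomial_identity :: "'m::finite itself \<Rightarrow> 'n::finite free_algebra \<Rightarrow> bool" where
  "polynomial_identity _ f \<longleftrightarrow>
     subst_matrices (generic_matrix :: 'n \<Rightarrow> ('n \<times> 'm \<times> 'm) mpoly^'m^'m) f = 0"

lemma mpoly_const_0 [simp]: "mpoly_const 0 = 0"
  and mpoly_const_1 [simp]: "mpoly_const 1 = 1"
  and mpoly_const_add: "mpoly_const (a + b) = mpoly_const a + mpoly_const b"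
  and mpoly_const_mult: "mpoly_const (a * b) = mpoly_const a * mpoly_const b"
  by (simp_all add: mpoly_const_def single_add mult_single)

lemma mat_add: "mat (a + b) = (mat a + mat b :: 'r::semiring_1^'m^'m)"
  by (simp add: mat_def vec_eq_iff)

lemma mat_matrix_mult: "(mat a ** B :: 'r::semiring_1^'m^'m) = (\<chi> i j. a * B $ i $ j)"
  by (simp add: mat_def matrix_matrix_mult_def vec_eq_iff if_distrib if_distribR sum.delta'
      cong: if_cong)

lemma matrix_mult_mat: "(B ** mat a :: 'r::comm_semiring_1^'m^'m) = mat a ** B"
  unfolding mat_matrix_mult
  by (simp add: mat_def matrix_matrix_mult_def vec_eq_iff if_distrib if_distribR sum.delta
      mult.commute cong: if_cong)

lemma mat_mult_mat: "(mat a ** mat b :: 'r::semiring_1^'m^'m) = mat (a * b)"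
  unfolding mat_matrix_mult by (simp add: mat_def vec_eq_iff)

lemma matrix_mult_add_left: "((A + B) ** C :: 'r::semiring_1^'m^'m) = A ** C + B ** C"
  by (simp add: matrix_matrix_mult_def vec_eq_iff distrib_right sum.distrib)

lemma word_prod_append: "word_prod A (v @ w) = word_prod A v ** word_prod A w"
  by (induction v) (simp_all add: matrix_mul_assoc)

lemma subst_matrices_superset:
  assumes "finite K" "Poly_Mapping.keys f \<subseteq> K"
  shows "subst_matrices A f =
    (\<Sum>w\<in>K. mat (mpoly_const (Poly_Mapping.lookup f w)) ** word_prod A w)"
  unfolding subst_matrices_def using assms
  by (intro sum.mono_neutral_left) (auto simp: in_keys_iff)

lemma subst_matrices_zero [simp]: "subst_matrices A 0 = 0"
  by (simp add: subst_matrices_def)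

lemma subst_matrices_single:
  "subst_matrices A (Poly_Mapping.single w c) = mat (mpoly_const c) ** word_prod A w"
  by (simp add: subst_matrices_superset[of "{w}"])

lemma subst_matrices_one [simp]: "subst_matrices A 1 = mat 1"
  using subst_matrices_single[of A 0 1] unfolding single_one by (simp add: zero_list_def)

lemma subst_matrices_add: "subst_matrices A (f + g) = subst_matrices A f + subst_matrices A g"
proof -
  let ?K = "Poly_Mapping.keys f \<union> Poly_Mapping.keys g"
  have "Poly_Mapping.keys (f + g) \<subseteq> ?K" by (rule Poly_Mapping.keys_add)
  then show ?thesis
    by (simp add: subst_matrices_superset[of ?K] lookup_add mpoly_const_add mat_add
        matrix_mult_add_left sum.distrib)
qed

lemma subst_matrices_uminus: "subst_matrices A (- f) = - subst_matrices A f"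
  using subst_matrices_add[of A f "- f"] by (simp add: eq_neg_iff_add_eq_0 add.commute)

lemma subst_matrices_diff: "subst_matrices A (f - g) = subst_matrices A f - subst_matrices A g"
  using subst_matrices_add[of A f "- g"] by (simp add: subst_matrices_uminus)

lemma poly_mapping_single_add_induct [case_names zero add single]:
  assumes zero: "P 0" and add: "\<And>f g. P f \<Longrightarrow> P g \<Longrightarrow> P (f + g)"
    and single: "\<And>w c. P (Poly_Mapping.single w c)"
  shows "P (f :: 'k \<Rightarrow>\<^sub>0 'b::comm_monoid_add)"
proof -
  have "P (\<Sum>w\<in>K. Poly_Mapping.single w (Poly_Mapping.lookup f w))" if "finite K" for K
    using that by (induction K) (simp_all add: zero add single)
  moreover have "f = (\<Sum>w\<in>Poly_Mapping.keys f. Poly_Mapping.single w (Poly_Mapping.lookup f w))"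
    by (rule poly_mapping_eqI)
      (auto simp: lookup_sum lookup_single when_def in_keys_iff)
  ultimately show ?thesis by (metis finite_keys)
qed

lemma subst_matrices_mult: "subst_matrices A (f * g) = subst_matrices A f ** subst_matrices A g"
proof (induction f rule: poly_mapping_single_add_induct)
  case (single v a)
  show ?case
  proof (induction g rule: poly_mapping_single_add_induct)
    case (single w b)
    have "mat (mpoly_const (a * b)) ** (word_prod A v ** word_prod A w)
        = mat (mpoly_const a) ** (mat (mpoly_const b) ** word_prod A v) ** word_prod A w"
      by (simp add: mpoly_const_mult mat_mult_mat matrix_mul_assoc)
    also have "\<dots> = (mat (mpoly_const a) ** word_prod A v) ** (mat (mpoly_const b) ** word_prod A w)"
      by (simp only: matrix_mult_mat[symmetric, of "mpoly_const b" "word_prod A v"] matrix_mul_assoc)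
    finally show ?case
      by (simp add: mult_single subst_matrices_single word_prod_append plus_list_def)
  qed (simp_all add: distrib_left subst_matrices_add matrix_add_ldistrib)
qed (simp_all add: distrib_right subst_matrices_add matrix_mult_add_left)

definition pi_congruent ::
    "'m::finite itself \<Rightarrow> 'n::finite free_algebra \<Rightarrow> 'n free_algebra \<Rightarrow> bool" where
  "pi_congruent M f g \<longleftrightarrow> polynomial_identity M (f - g)"

lemma pi_congruent_iff:
  "pi_congruent TYPE('m::finite) f g \<longleftrightarrow>
     subst_matrices (generic_matrix :: 'n::finite \<Rightarrow> ('n \<times> 'm \<times> 'm) mpoly^'m^'m) f =
     subst_matrices generic_matrix g"
  by (simp add: pi_congruent_def polynomial_identity_def subst_matrices_diff)

quotient_type ('m, 'n) generic_matrix_ring =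
  "'n::finite free_algebra" / "pi_congruent TYPE('m::finite)"
  by (rule equivpI) (auto simp: reflp_def symp_def transp_def pi_congruent_iff)

instantiation generic_matrix_ring :: (finite, finite) ring_1
begin

lift_definition zero_generic_matrix_ring :: "('a, 'b) generic_matrix_ring" is 0 .
lift_definition one_generic_matrix_ring :: "('a, 'b) generic_matrix_ring" is 1 .
lift_definition plus_generic_matrix_ring ::
  "('a, 'b) generic_matrix_ring \<Rightarrow> ('a, 'b) generic_matrix_ring \<Rightarrow> ('a, 'b) generic_matrix_ring"
  is "(+)" by (simp add: pi_congruent_iff subst_matrices_add)
lift_definition minus_generic_matrix_ring ::
  "('a, 'b) generic_matrix_ring \<Rightarrow> ('a, 'b) generic_matrix_ring \<Rightarrow> ('a, 'b) generic_matrix_ring"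
  is "(-)" by (simp add: pi_congruent_iff subst_matrices_diff)
lift_definition uminus_generic_matrix_ring ::
  "('a, 'b) generic_matrix_ring \<Rightarrow> ('a, 'b) generic_matrix_ring"
  is uminus by (simp add: pi_congruent_iff subst_matrices_uminus)
lift_definition times_generic_matrix_ring ::
  "('a, 'b) generic_matrix_ring \<Rightarrow> ('a, 'b) generic_matrix_ring \<Rightarrow> ('a, 'b) generic_matrix_ring"
  is "(*)" by (simp add: pi_congruent_iff subst_matrices_mult)

instance
proof
  show "(0 :: ('a, 'b) generic_matrix_ring) \<noteq> 1"
    by transfer (simp add: pi_congruent_iff mat_def vec_eq_iff)
qed (transfer; simp add: pi_congruent_iff algebra_simps)+

end

lift_definition generic_matrix_ring_scale ::
  "complex \<Rightarrow> ('m::finite, 'n::finite) generic_matrix_ring \<Rightarrow> ('m, 'n) generic_matrix_ring"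
  is "\<lambda>c f. Poly_Mapping.single [] c * f"
  by (simp add: pi_congruent_iff subst_matrices_mult)

interpretation generic_matrix_ring: vector_space generic_matrix_ring_scale
proof
  show "generic_matrix_ring_scale a (generic_matrix_ring_scale b x) =
      generic_matrix_ring_scale (a * b) x" for a b and x :: "('m::finite, 'n::finite) generic_matrix_ring"
    by transfer (simp add: pi_congruent_iff mult.assoc[symmetric] mult_single plus_list_def)
  show "generic_matrix_ring_scale 1 x = x" for x :: "('m::finite, 'n::finite) generic_matrix_ring"
    by transfer (simp add: pi_congruent_iff flip: zero_list_def)
qed (transfer; simp add: pi_congruent_iff algebra_simps single_add)+

text \<open>
  The multidegree of a word \<open>w\<close> is \<open>count_list w\<close>. The grading of the quotient consists of the
  images of the multihomogeneous components of the free algebra.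
\<close>

definition free_algebra_component :: "('n \<Rightarrow> nat) \<Rightarrow> 'n free_algebra set" where
  "free_algebra_component \<alpha> = {f. \<forall>w\<in>Poly_Mapping.keys f. count_list w = \<alpha>}"

definition generic_matrix_ring_component ::
    "('n::finite \<Rightarrow> nat) \<Rightarrow> ('m::finite, 'n) generic_matrix_ring set" where
  "generic_matrix_ring_component \<alpha> = abs_generic_matrix_ring ` free_algebra_component \<alpha>"


section \<open>Hilbert series\<close>

text \<open>
  A formal power series in the variables \<open>t_i\<close> (\<open>i :: 'n\<close>) is given by its coefficient function
  \<open>('n \<Rightarrow> nat) \<Rightarrow> rat\<close>.
\<close>

definition generic_matrix_ring_hilbert_series ::
    "'m::finite itself \<Rightarrow> 'n::finite itself \<Rightarrow> ('n \<Rightarrow> nat) \<Rightarrow> rat" where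
  "generic_matrix_ring_hilbert_series _ _ \<alpha> =
     of_nat (generic_matrix_ring.dim
       (generic_matrix_ring_component \<alpha> :: ('m, 'n) generic_matrix_ring set))"

text \<open>The substitution \<open>H(t, \<dots>, t)\<close> of one variable \<open>t\<close> for all variables of \<open>H\<close>.\<close>

definition fps_diagonal :: "(('n::finite \<Rightarrow> nat) \<Rightarrow> 'a) \<Rightarrow> 'a::comm_monoid_add fps" where
  "fps_diagonal H = Abs_fps (\<lambda>k. \<Sum>\<alpha> | (\<Sum>i\<in>UNIV. \<alpha> i) = k. H \<alpha>)"

lemma finite_multidegrees: "finite {\<alpha> :: 'n::finite \<Rightarrow> nat. (\<Sum>i\<in>UNIV. \<alpha> i) = k}"
proof (rule finite_subset)
  show "{\<alpha> :: 'n \<Rightarrow> nat. (\<Sum>i\<in>UNIV. \<alpha> i) = k} \<subseteq> (UNIV \<rightarrow>\<^sub>E {..k})"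
    by (auto simp: PiE_def intro!: member_le_sum)
  show "finite (UNIV \<rightarrow>\<^sub>E {..k} :: ('n \<Rightarrow> nat) set)"
    by (rule finite_PiE) simp_all
qed

end

theory Submission
  imports Defs
begin

text \<open>
  Write \<open>A, B\<close> for two generic \<open>2 \<times> 2\<close> matrices, \<open>Y = [A, B]\<close>, and \<open>M\<^sup>* = tr M - M\<close> for the adjugate.
  Since \<open>Y v(A, B) = v(A\<^sup>*, B\<^sup>*) Y\<close> for every word \<open>v\<close>, the commutator ideal of \<open>\<complex>\<langle>A, B\<rangle>\<close> is spanned by
  the products \<open>u(A, B) v(A\<^sup>*, B\<^sup>*) Y\<close>. The span of the factors \<open>u v\<^sup>*\<close> is closed under
  multiplication by \<open>tr A = A + A\<^sup>*\<close>, \<open>det A = A A\<^sup>*\<close>, their analogues for \<open>B\<close>, and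
  \<open>tr(A B\<^sup>*) = A B\<^sup>* + B A\<^sup>*\<close>; by Cayley-Hamilton it is the free module with basis \<open>1, A, B, A B\<close> over
  the polynomial ring in these five invariants. Modulo the commutator ideal every word is some
  \<open>A\<^sup>p B\<^sup>q\<close>. This gives an explicit homogeneous basis, which is counted. Its independence is tested at
  complex matrices: scalar matrices kill the ideal part, and triangular matrices realise all values of
  the invariants. Finally, the span of the tensors \<open>(Tr(X A\<^sub>w))\<^sub>w\<close> has the same dimension as the span of
  the functions \<open>A\<^sub>w\<close> (row rank equals column rank), and linear equations pass to the Zariski closure.
\<close>

section \<open>Evaluation of polynomials\<close>

definition monomial_eval :: "('v \<Rightarrow>\<^sub>0 nat) \<Rightarrow> ('v \<Rightarrow> complex) \<Rightarrow> complex" where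
  "monomial_eval \<mu> x = (\<Prod>v\<in>Poly_Mapping.keys \<mu>. x v ^ Poly_Mapping.lookup \<mu> v)"

lemma monomial_eval_superset:
  assumes "finite K" "Poly_Mapping.keys \<mu> \<subseteq> K"
  shows "monomial_eval \<mu> x = (\<Prod>v\<in>K. x v ^ Poly_Mapping.lookup \<mu> v)"
  unfolding monomial_eval_def using assms
  by (intro prod.mono_neutral_left) (auto simp: in_keys_iff)

lemma monomial_eval_add: "monomial_eval (\<mu> + \<nu>) x = monomial_eval \<mu> x * monomial_eval \<nu> x"
proof -
  let ?K = "Poly_Mapping.keys \<mu> \<union> Poly_Mapping.keys \<nu>"
  have "Poly_Mapping.keys (\<mu> + \<nu>) \<subseteq> ?K" by (rule Poly_Mapping.keys_add)
  then show ?thesis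
    by (simp add: monomial_eval_superset[of ?K] lookup_add power_add prod.distrib)
qed

lemma mpoly_eval_superset:
  assumes "finite K" "Poly_Mapping.keys p \<subseteq> K"
  shows "mpoly_eval p x = (\<Sum>\<mu>\<in>K. Poly_Mapping.lookup p \<mu> * monomial_eval \<mu> x)"
  unfolding mpoly_eval_def monomial_eval_def[symmetric] using assms
  by (intro sum.mono_neutral_left) (auto simp: in_keys_iff)

lemma mpoly_eval_zero [simp]: "mpoly_eval 0 x = 0"
  by (simp add: mpoly_eval_def)

lemma mpoly_eval_single: "mpoly_eval (Poly_Mapping.single \<mu> c) x = c * monomial_eval \<mu> x"
  by (simp add: mpoly_eval_superset[of "{\<mu>}"])

lemma mpoly_eval_add: "mpoly_eval (p + q) x = mpoly_eval p x + mpoly_eval q x"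
proof -
  let ?K = "Poly_Mapping.keys p \<union> Poly_Mapping.keys q"
  have "Poly_Mapping.keys (p + q) \<subseteq> ?K" by (rule Poly_Mapping.keys_add)
  then show ?thesis
    by (simp add: mpoly_eval_superset[of ?K] lookup_add distrib_right sum.distrib)
qed

lemma mpoly_eval_mult: "mpoly_eval (p * q) x = mpoly_eval p x * mpoly_eval q x"
proof (induction p rule: poly_mapping_single_add_induct)
  case (single \<mu> a)
  show ?case
    by (induction q rule: poly_mapping_single_add_induct)
      (simp_all add: mult_single mpoly_eval_single monomial_eval_add mpoly_eval_add distrib_left)
qed (simp_all add: distrib_right mpoly_eval_add)

lemma mpoly_eval_const [simp]: "mpoly_eval (mpoly_const c) x = c"
  by (simp add: mpoly_const_def mpoly_eval_single monomial_eval_def)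

lemma mpoly_eval_one [simp]: "mpoly_eval 1 x = 1"
  using mpoly_eval_const[of 1 x] by simp

lemma mpoly_eval_var [simp]: "mpoly_eval (mpoly_var v) x = x v"
  by (simp add: mpoly_var_def mpoly_eval_single monomial_eval_def)

lemma mpoly_eval_diff: "mpoly_eval (p - q) x = mpoly_eval p x - mpoly_eval q x"
  using mpoly_eval_add[of "p - q" q x] by simp

lemma mpoly_eval_sum: "mpoly_eval (\<Sum>i\<in>I. p i) x = (\<Sum>i\<in>I. mpoly_eval (p i) x)"
  by (induction I rule: infinite_finite_induct) (simp_all add: mpoly_eval_add)

lemma mpoly_eval_power: "mpoly_eval (p ^ n) x = mpoly_eval p x ^ n"
  by (induction n) (simp_all add: mpoly_eval_mult)

section \<open>Specialisation of polynomial matrices\<close>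

definition eval_matrix :: "('v \<Rightarrow> complex) \<Rightarrow> 'v mpoly^'m^'m \<Rightarrow> complex^'m^'m" where
  "eval_matrix x M = (\<chi> i j. mpoly_eval (M $ i $ j) x)"

lemma eval_matrix_zero [simp]: "eval_matrix x 0 = 0"
  by (simp add: eval_matrix_def vec_eq_iff)

lemma eval_matrix_diff: "eval_matrix x (M - N) = eval_matrix x M - eval_matrix x N"
  by (simp add: eval_matrix_def vec_eq_iff mpoly_eval_diff)

lemma eval_matrix_sum: "eval_matrix x (\<Sum>i\<in>I. M i) = (\<Sum>i\<in>I. eval_matrix x (M i))"
  by (simp add: eval_matrix_def vec_eq_iff mpoly_eval_sum)

lemma eval_matrix_mult: "eval_matrix x (M ** N) = eval_matrix x M ** eval_matrix x N"
  by (simp add: eval_matrix_def vec_eq_iff matrix_matrix_mult_def mpoly_eval_sum mpoly_eval_mult)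

lemma eval_matrix_mat: "eval_matrix x (mat p) = mat (mpoly_eval p x)"
  by (simp add: eval_matrix_def vec_eq_iff mat_def)

lemma eval_matrix_word_prod:
  "eval_matrix x (word_prod A w) = word_prod (\<lambda>i. eval_matrix x (A i)) w"
  by (induction w) (simp_all add: eval_matrix_mult eval_matrix_mat)

text \<open>Sending the variable \<open>(i, j, k)\<close> to the corresponding entry of
  \<open>A i\<close> transports every linear relation between words in generic matrices to the
  complex matrices \<open>A\<close>.\<close>

lemma eval_generic_matrix:
  "eval_matrix (\<lambda>(i, j, k). A i $ j $ k) (generic_matrix i) = A i"
  by (simp add: eval_matrix_def vec_eq_iff generic_matrix_def)


section \<open>Linear algebra\<close>

lemma matrix_mult_sum_right:
  "(M ** (\<Sum>i\<in>I. N i) :: 'r::semiring_1^'m^'m) = (\<Sum>i\<in>I. M ** N i)"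
  by (induction I rule: infinite_finite_induct) (simp_all add: matrix_add_ldistrib)

lemma matrix_mult_sum_left:
  "((\<Sum>i\<in>I. N i) ** M :: 'r::semiring_1^'m^'m) = (\<Sum>i\<in>I. N i ** M)"
  by (induction I rule: infinite_finite_induct) (simp_all add: matrix_mult_add_left)

lemma (in vector_space) sum_scale_delta:
  assumes "finite I" "j \<in> I"
  shows "(\<Sum>i\<in>I. scale (if i = j then a else 0) (f i)) = scale a (f j)"
proof -
  have "(\<Sum>i\<in>I. scale (if i = j then a else 0) (f i)) = (\<Sum>i\<in>I. if i = j then scale a (f i) else 0)"
    by (intro sum.cong) auto
  then show ?thesis using assms by simp
qed

lemma sum_mult_delta:
  fixes h :: "'b \<Rightarrow> complex"
  assumes "finite I" "j \<in> I"
  shows "(\<Sum>i\<in>I. (if i = j then 1 else 0) * h i) = h j"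
proof -
  have "(\<Sum>i\<in>I. (if i = j then 1 else 0) * h i) = (\<Sum>i\<in>I. if i = j then h i else 0)"
    by (intro sum.cong) auto
  then show ?thesis using assms by simp
qed

lemma (in vector_space) span_family_sum:
  assumes "finite I" "x \<in> span (f ` I)"
  shows "\<exists>c. x = (\<Sum>i\<in>I. scale (c i) (f i))"
  using assms(2)
proof (induction rule: span_induct_alt)
  case base
  show ?case by (intro exI[of _ "\<lambda>_. 0"]) simp
next
  case (step a y z)
  then obtain c j where c: "z = (\<Sum>i\<in>I. scale (c i) (f i))" and j: "j \<in> I" "y = f j" by auto
  have "scale a y = (\<Sum>i\<in>I. scale (if i = j then a else 0) (f i))"
    using j assms(1) by (simp add: sum_scale_delta)
  then have "scale a y + z = (\<Sum>i\<in>I. scale ((if i = j then a else 0) + c i) (f i))"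
    by (simp add: c scale_left_distrib sum.distrib)
  then show ?case by (rule exI[of _ "\<lambda>i. (if i = j then a else 0) + c i"])
qed

text \<open>The basis is given as an indexed family, so that the dimension is the size of the index
  set. Distinctness of the vectors follows from independence, applied to the coefficients 1 at
  \<open>i\<close> and -1 at \<open>j\<close>.\<close>

lemma (in vector_space) dim_eq_card_family:
  assumes fin: "finite I"
    and ind: "\<And>c. (\<Sum>i\<in>I. scale (c i) (f i)) = 0 \<Longrightarrow> \<forall>i\<in>I. c i = 0"
    and sub: "f ` I \<subseteq> V" and span: "V \<subseteq> span (f ` I)"
  shows "dim V = card I"
proof -
  have inj: "inj_on f I"
  proof
    fix i j assume ij: "i \<in> I" "j \<in> I" "f i = f j"
    show "i = j"
    proof (rule ccontr)
      assume "i \<noteq> j"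
      let ?c = "\<lambda>k. (if k = i then 1 else 0) - (if k = j then 1 else 0)"
      have "(\<Sum>k\<in>I. scale (?c k) (f k)) = f i - f j"
        using ij fin by (simp only: scale_left_diff_distrib sum_subtractf sum_scale_delta scale_one)
      with ind[of ?c] ij \<open>i \<noteq> j\<close> show False by auto
    qed
  qed
  have "independent (f ` I)"
  proof (rule independent_if_scalars_zero)
    show "finite (f ` I)" using fin by simp
    fix u x assume "(\<Sum>x\<in>f ` I. scale (u x) x) = 0" "x \<in> f ` I"
    then show "u x = 0"
      using ind[of "u \<circ> f"] inj by (auto simp: sum.reindex)
  qed
  then show ?thesis
    using dim_unique[OF sub span] card_image[OF inj] by simp
qed

text \<open>Independent functions are separated by finite combinations of point evaluations. The
  induction is Gram-Schmidt for functionals: subtract from \<open>g b0\<close> its components along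
  \<open>B\<close>, evaluate the remainder at a point where it is nonzero, and correct the old
  functionals by the new one.\<close>

lemma exists_dual_combination:
  fixes g :: "'b \<Rightarrow> 'p \<Rightarrow> complex"
  assumes "finite B"
    and "\<And>c. (\<And>p. (\<Sum>b\<in>B. c b * g b p) = 0) \<Longrightarrow> \<forall>b\<in>B. c b = 0"
  shows "\<exists>(P :: 'p set) y. finite P \<and>
    (\<forall>b\<in>B. \<forall>b'\<in>B. (\<Sum>p\<in>P. y b p * g b' p) = (if b = b' then 1 else 0))"
  using assms
proof (induction B rule: finite_induct)
  case empty
  then show ?case by auto
next
  case (insert b0 B)
  have "\<forall>b\<in>B. c b = 0" if "\<And>p. (\<Sum>b\<in>B. c b * g b p) = 0" for c
  proof -
    have "(\<Sum>b\<in>insert b0 B. (if b = b0 then 0 else c b) * g b p) = 0" for p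
      using insert.hyps that[of p]
      by (auto simp: sum.insert_if intro!: trans[OF sum.cong[OF refl] that[of p]])
    from insert.prems[OF this] insert.hyps show ?thesis by (metis insertCI)
  qed
  with insert.IH obtain P y where P: "finite P"
    and y: "\<And>b b'. b \<in> B \<Longrightarrow> b' \<in> B \<Longrightarrow>
      (\<Sum>p\<in>P. y b p * g b' p) = (if b = b' then 1 else 0)" by blast
  define l where "l b = (\<Sum>p\<in>P. y b p * g b0 p)" for b
  define h where "h p = g b0 p - (\<Sum>b\<in>B. l b * g b p)" for p
  have "\<exists>p. h p \<noteq> 0"
  proof (rule ccontr)
    assume neg: "\<not> (\<exists>p. h p \<noteq> 0)"
    have "(\<Sum>b\<in>insert b0 B. (if b = b0 then 1 else - l b) * g b p) = h p" for p
    proof -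
      have "(\<Sum>b\<in>B. (if b = b0 then 1 else - l b) * g b p) = (\<Sum>b\<in>B. - l b * g b p)"
        using insert.hyps by (intro sum.cong) auto
      then show ?thesis using insert.hyps by (simp add: h_def sum_negf)
    qed
    with neg insert.prems[of "\<lambda>b. if b = b0 then 1 else - l b"] show False by auto
  qed
  then obtain q where q: "h q \<noteq> 0" by blast
  define Q where "Q = insert q P"
  \<comment> \<open>The new point \<open>q\<close> may lie outside \<open>P\<close>, where nothing
    is known about \<open>y b\<close>; cutting off there keeps the old functionals unchanged on
    \<open>Q\<close>.\<close>
  define y1 where "y1 b p = (if p \<in> P then y b p else 0)" for b p
  define e where "e p = (if p = q then 1 else 0 :: complex)" for p
  \<comment> \<open>Evaluation at \<open>q\<close> minus its components along the old functionals:
    this vanishes on \<open>g b\<close> for \<open>b\<close> in \<open>B\<close>, and takes the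
    value \<open>h q / h q = 1\<close> on \<open>g b0\<close>.\<close>
  define y0 where "y0 p = (e p - (\<Sum>b\<in>B. g b q * y1 b p)) / h q" for p
  have Q: "finite Q" using P by (simp add: Q_def)
  have y1: "(\<Sum>p\<in>Q. y1 b p * g b' p) = (\<Sum>p\<in>P. y b p * g b' p)" for b b'
    unfolding y1_def Q_def using P
    by (intro sum.mono_neutral_cong_right) auto
  have e: "(\<Sum>p\<in>Q. e p * g b p) = g b q" for b
    unfolding e_def using Q by (rule sum_mult_delta) (simp add: Q_def)
  have y0: "(\<Sum>p\<in>Q. y0 p * g b' p) =
      (g b' q - (\<Sum>b\<in>B. g b q * (\<Sum>p\<in>P. y b p * g b' p))) / h q" for b'
  proof -
    have "(\<Sum>p\<in>Q. y0 p * g b' p)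
        = ((\<Sum>p\<in>Q. e p * g b' p) - (\<Sum>p\<in>Q. \<Sum>b\<in>B. g b q * (y1 b p * g b' p))) / h q"
      by (simp add: y0_def sum_divide_distrib[symmetric] left_diff_distrib sum_subtractf
          sum_distrib_right mult.assoc)
    also have "(\<Sum>p\<in>Q. \<Sum>b\<in>B. g b q * (y1 b p * g b' p))
        = (\<Sum>b\<in>B. g b q * (\<Sum>p\<in>Q. y1 b p * g b' p))"
      by (subst sum.swap) (simp add: sum_distrib_left)
    finally show ?thesis by (simp add: e y1)
  qed
  have y0_B: "(\<Sum>p\<in>Q. y0 p * g b' p) = 0" if "b' \<in> B" for b'
  proof -
    have "(\<Sum>b\<in>B. g b q * (\<Sum>p\<in>P. y b p * g b' p)) = (\<Sum>b\<in>B. if b = b' then g b q else 0)"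
      using that by (intro sum.cong) (auto simp: y)
    then show ?thesis using that insert.hyps by (simp add: y0)
  qed
  have y0_b0: "(\<Sum>p\<in>Q. y0 p * g b0 p) = 1"
  proof -
    have "(\<Sum>b\<in>B. g b q * (\<Sum>p\<in>P. y b p * g b0 p)) = (\<Sum>b\<in>B. l b * g b q)"
      by (intro sum.cong) (simp_all add: l_def)
    then show ?thesis using q by (simp add: y0 h_def)
  qed
  define z where "z b p = (if b = b0 then y0 p else y1 b p - l b * y0 p)" for b p
  have "(\<Sum>p\<in>Q. z b p * g b' p) = (if b = b' then 1 else 0)"
    if "b \<in> insert b0 B" "b' \<in> insert b0 B" for b b'
  proof (cases "b = b0")
    case True
    then show ?thesis using that insert.hyps y0_B y0_b0 by (auto simp: z_def)
  next
    case False
    then have "(\<Sum>p\<in>Q. z b p * g b' p)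
        = (\<Sum>p\<in>P. y b p * g b' p) - l b * (\<Sum>p\<in>Q. y0 p * g b' p)"
      by (simp add: z_def left_diff_distrib sum_subtractf y1 sum_distrib_left mult.assoc)
    then show ?thesis
      using that False insert.hyps y0_B y0_b0 by (auto simp: y l_def)
  qed
  with Q show ?case by blast
qed

lemma sum_tensor_apply: "(\<Sum>i\<in>I. T i) w = (\<Sum>i\<in>I. T i w :: complex)"
  by (induction I rule: infinite_finite_induct) (simp_all add: plus_fun_def zero_fun_def)

text \<open>
  If the coordinates of a parametrisation \<open>f\<close> and a linearly independent family \<open>g\<close> span the same
  functions, then the transition coefficients are linear equations for \<open>range f\<close>, which therefore
  survive in its closure.
\<close>

lemma dim_span_zariski_closure:
  fixes f :: "'p \<Rightarrow> 'n::finite list \<Rightarrow> complex" and g :: "'b \<Rightarrow> 'p \<Rightarrow> complex"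
  assumes B: "finite B"
    and f: "\<And>p w. length w = d \<Longrightarrow> f p w = (\<Sum>b\<in>B. c w b * g b p)"
    and f0: "\<And>p. f p \<in> tensor_space d"
    and g: "\<And>b p. b \<in> B \<Longrightarrow> g b p = (\<Sum>w | length w = d. e b w * f p w)"
    and ind: "\<And>a. (\<And>p. (\<Sum>b\<in>B. a b * g b p) = 0) \<Longrightarrow> \<forall>b\<in>B. a b = 0"
  shows "tensor.dim (tensor.span (zariski_closure (tensor_space d) (range f))) = card B"
proof (rule tensor.dim_eq_card_family[OF B])
  let ?W = "{w :: 'n list. length w = d}"
  have W: "finite ?W" using finite_lists_length_eq[of "UNIV :: 'n set" d] by simp
  \<comment> \<open>The columns of the transition matrix \<open>c\<close> are the tensors that will
    form a basis of the span.\<close>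
  define x where "x b = (\<lambda>w. if length w = d then c w b else 0)" for b
  \<comment> \<open>Substituting the expansion of \<open>f\<close> into that of \<open>g\<close>
    writes \<open>g b\<close> in terms of the family \<open>g\<close>; by independence
    \<open>e\<close> is a left inverse of \<open>c\<close>.\<close>
  have dual: "(\<Sum>w\<in>?W. e b w * c w b') = (if b = b' then 1 else 0)" if "b \<in> B" "b' \<in> B" for b b'
  proof -
    let ?k = "\<lambda>b'. (\<Sum>w\<in>?W. e b w * c w b') - (if b' = b then 1 else 0)"
    have "(\<Sum>b'\<in>B. ?k b' * g b' p) = 0" for p
    proof -
      have "(\<Sum>b'\<in>B. (\<Sum>w\<in>?W. e b w * c w b') * g b' p)
          = (\<Sum>w\<in>?W. e b w * (\<Sum>b'\<in>B. c w b' * g b' p))"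
        unfolding sum_distrib_left sum_distrib_right by (subst sum.swap) (simp add: mult.assoc)
      also have "\<dots> = (\<Sum>w\<in>?W. e b w * f p w)" by (simp add: f)
      finally show ?thesis
        using that B g[of b p] by (simp only: left_diff_distrib sum_subtractf sum_mult_delta) simp
    qed
    from ind[OF this] that show ?thesis by auto
  qed
  show "\<forall>b\<in>B. a b = 0" if "(\<Sum>b\<in>B. tensor_scale (a b) (x b)) = 0" for a
  proof
    fix b assume b: "b \<in> B"
    have "(\<Sum>b'\<in>B. a b' * c w b') = 0" if "w \<in> ?W" for w
      using that fun_cong[OF \<open>(\<Sum>b\<in>B. tensor_scale (a b) (x b)) = 0\<close>, of w]
      by (simp add: sum_tensor_apply tensor_scale_def x_def)
    then have "0 = (\<Sum>w\<in>?W. e b w * (\<Sum>b'\<in>B. a b' * c w b'))" by simp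
    also have "\<dots> = (\<Sum>b'\<in>B. a b' * (\<Sum>w\<in>?W. e b w * c w b'))"
      unfolding sum_distrib_left by (subst sum.swap) (simp add: mult_ac)
    also have "\<dots> = (\<Sum>b'\<in>B. if b = b' then a b' else 0)"
      using b by (intro sum.cong) (simp_all add: dual)
    finally show "a b = 0" using b B by simp
  qed
  obtain P y where P: "finite P"
    and y: "\<And>b b'. b \<in> B \<Longrightarrow> b' \<in> B \<Longrightarrow>
      (\<Sum>p\<in>P. y b p * g b' p) = (if b = b' then 1 else 0)"
    using exists_dual_combination[of B g, OF B ind] by blast
  have closure: "range f \<subseteq> zariski_closure (tensor_space d) (range f)"
    using f0 by (auto simp: zariski_closure_def)
  \<comment> \<open>The dual functionals extract the column \<open>x b\<close> from finitely many
    points of the image itself.\<close>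
  have "x b = (\<Sum>p\<in>P. tensor_scale (y b p) (f p))" if b: "b \<in> B" for b
  proof
    fix w
    show "x b w = (\<Sum>p\<in>P. tensor_scale (y b p) (f p)) w"
    proof (cases "length w = d")
      case True
      have "(\<Sum>p\<in>P. y b p * (\<Sum>b'\<in>B. c w b' * g b' p))
          = (\<Sum>b'\<in>B. c w b' * (\<Sum>p\<in>P. y b p * g b' p))"
        unfolding sum_distrib_left by (subst sum.swap) (simp add: mult_ac)
      also have "\<dots> = (\<Sum>b'\<in>B. if b = b' then c w b' else 0)"
        using b by (intro sum.cong) (simp_all add: y)
      finally show ?thesis
        using True b B by (simp add: sum_tensor_apply tensor_scale_def x_def f)
    next
      case False
      then show ?thesis
        using f0 by (simp add: sum_tensor_apply tensor_scale_def x_def tensor_space_def)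
    qed
  qed
  then show "x ` B \<subseteq> tensor.span (zariski_closure (tensor_space d) (range f))"
  proof (intro image_subsetI)
    fix b assume "b \<in> B" "\<And>b. b \<in> B \<Longrightarrow> x b = (\<Sum>p\<in>P. tensor_scale (y b p) (f p))"
    moreover have "f p \<in> tensor.span (zariski_closure (tensor_space d) (range f))" for p
      using closure by (auto intro: tensor.span_base)
    ultimately show "x b \<in> tensor.span (zariski_closure (tensor_space d) (range f))"
      by (simp only: tensor.span_sum tensor.span_scale)
  qed
  show "tensor.span (zariski_closure (tensor_space d) (range f)) \<subseteq> tensor.span (x ` B)"
  proof (rule tensor.span_minimal[OF _ tensor.subspace_span], rule subsetI)
    fix T assume T: "T \<in> zariski_closure (tensor_space d) (range f)"
    define l where "l b = (\<Sum>v\<in>?W. e b v * T v)" for b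
    have Tw: "T w = (\<Sum>b\<in>B. c w b * l b)" if w: "length w = d" for w
    proof -
      \<comment> \<open>The linear form expressing that the coordinate at \<open>w\<close> is
        recovered from the values \<open>l b\<close>. It vanishes on the image, hence on the
        closure.\<close>
      define p where "p = mpoly_var w -
        (\<Sum>b\<in>B. mpoly_const (c w b) * (\<Sum>v\<in>?W. mpoly_const (e b v) * mpoly_var v))"
      have p: "mpoly_eval p U = U w - (\<Sum>b\<in>B. c w b * (\<Sum>v\<in>?W. e b v * U v))" for U
        by (simp add: p_def mpoly_eval_diff mpoly_eval_sum mpoly_eval_mult)
      have "mpoly_eval p (f q) = 0" for q
        using f[OF w, of q] g[of _ q] by (simp add: p)
      then have "mpoly_eval p T = 0" using T by (auto simp: zariski_closure_def)
      then show ?thesis by (simp add: p l_def)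
    qed
    have "T = (\<Sum>b\<in>B. tensor_scale (l b) (x b))"
    proof
      fix w show "T w = (\<Sum>b\<in>B. tensor_scale (l b) (x b)) w"
        using T by (cases "length w = d")
          (simp_all add: Tw sum_tensor_apply tensor_scale_def x_def mult.commute
            zariski_closure_def tensor_space_def)
    qed
    then show "T \<in> tensor.span (x ` B)"
      by (simp add: tensor.span_sum tensor.span_scale tensor.span_base)
  qed
qed


section \<open>Two by two matrices\<close>

definition adj2 :: "'r::comm_ring_1^2^2 \<Rightarrow> 'r^2^2" where
  "adj2 M = mat (trace M) - M"

definition commutator :: "(2 \<Rightarrow> 'r::comm_ring_1^2^2) \<Rightarrow> 'r^2^2" where
  "commutator A = A 1 ** A 2 - A 2 ** A 1"

text \<open>The polarised determinant: it equals det(A + B) - det A - det B, or tr A tr B - tr(A B),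
  for A = \<open>A 1\<close> and B = \<open>A 2\<close>.\<close>

definition mixed_trace :: "(2 \<Rightarrow> 'r::comm_ring_1^2^2) \<Rightarrow> 'r" where
  "mixed_trace A = trace (A 1 ** adj2 (A 2))"

lemmas matrix2_simps = vec_eq_iff forall_2 sum_2 matrix_matrix_mult_def trace_def mat_def
  adj2_def det_2 mixed_trace_def commutator_def

lemma mult_adj2: "A ** adj2 A = mat (det A)"
  by (simp add: matrix2_simps algebra_simps)

lemma mult_adj2_mixed: "A 1 ** adj2 (A 2) + A 2 ** adj2 (A 1) = mat (mixed_trace A)"
  by (simp add: matrix2_simps algebra_simps)

text \<open>Conceptually, tr Y = 0 and tr(Y A_i) = 0 for the commutator Y, so the polarised
  Cayley-Hamilton identity reads Y A_i + A_i Y = tr(A_i) Y. In size two a comparison of entries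
  suffices.\<close>

lemma commutator_mult: "commutator A ** A i = adj2 (A i) ** commutator A"
proof -
  have "i = 1 \<or> i = 2" by (rule exhaust_2)
  then show ?thesis by (elim disjE) (simp_all add: matrix2_simps algebra_simps)
qed

lemma commutator_word_prod:
  "commutator A ** word_prod A w = word_prod (\<lambda>i. adj2 (A i)) w ** commutator A"
  by (induction w) (simp_all add: matrix_mul_assoc commutator_mult,
      simp add: matrix_mul_assoc[symmetric])

lemma square_2: "M ** M = mat (trace M) ** M - mat (det M)" for M :: "'r::comm_ring_1^2^2"
  by (simp add: matrix2_simps algebra_simps)

text \<open>This is \<open>mult_adj2_mixed\<close> with the adjugates expanded; it reorders the two
  letters.\<close>

lemma swap_2: "A 2 ** A 1 =
    mat (trace (A 2)) ** A 1 + mat (trace (A 1)) ** A 2 - A 1 ** A 2 - mat (mixed_trace A)"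
  by (simp add: matrix2_simps algebra_simps)

text \<open>Multiply \<open>swap_2\<close> on the right by \<open>A 2\<close> and reduce the square
  of \<open>A 2\<close> by Cayley-Hamilton; the two terms tr(A_2) A_1 A_2 cancel.\<close>

lemma left_mult_121: "A 2 ** (A 1 ** A 2) =
    mat (det (A 2)) ** A 1 + mat (trace (A 1) * trace (A 2)) ** A 2
    - mat (trace (A 1) * det (A 2)) - mat (mixed_trace A) ** A 2"
  by (simp add: matrix2_simps algebra_simps)

text \<open>
  The index \<open>(m, i, j, k, l)\<close> stands for a trace monomial times \<open>A\<^sup>r B\<^sup>s\<close> with \<open>r, s \<le> 1\<close>; merging
  \<open>det A\<^sup>k' A\<^sup>r\<close> into the single exponent \<open>k = 2 k' + r\<close> gives it the degree \<open>(i + k + m, j + l + m)\<close>.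
\<close>

type_synonym trace_index = "nat \<times> nat \<times> nat \<times> nat \<times> nat"

fun trace_coeff :: "trace_index \<Rightarrow> (2 \<Rightarrow> 'r::comm_ring_1^2^2) \<Rightarrow> 'r" where
  "trace_coeff (m, i, j, k, l) A = mixed_trace A ^ m * (trace (A 1) ^ i * (trace (A 2) ^ j *
     (det (A 1) ^ (k div 2) * det (A 2) ^ (l div 2))))"

fun trace_word :: "trace_index \<Rightarrow> 2 list" where
  "trace_word (m, i, j, k, l) = replicate (k mod 2) 1 @ replicate (l mod 2) 2"

definition trace_basis :: "trace_index \<Rightarrow> (2 \<Rightarrow> 'r::comm_ring_1^2^2) \<Rightarrow> 'r^2^2" where
  "trace_basis t A = mat (trace_coeff t A) ** word_prod A (trace_word t)"

fun trace_degree1 :: "trace_index \<Rightarrow> nat" where "trace_degree1 (m, i, j, k, l) = i + k + m"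
fun trace_degree2 :: "trace_index \<Rightarrow> nat" where "trace_degree2 (m, i, j, k, l) = j + l + m"

lemma mult_mat_assoc: "M ** (mat c ** N) = mat c ** (M ** N)" for M :: "'r::comm_ring_1^'m^'m" and N :: "'r^'n^'m"
  by (simp only: matrix_mul_assoc matrix_mult_mat)

lemma mat_mat_mult: "mat c ** (mat e ** N) = mat (c * e) ** N" for N :: "'r::comm_ring_1^'n^'m"
  by (simp only: matrix_mul_assoc mat_mult_mat)

lemma matrix_diff_ldistrib: "M ** (N - P) = M ** N - M ** P" for M :: "'r::ring_1^'n^'m"
  by (simp add: matrix_matrix_mult_def vec_eq_iff right_diff_distrib sum_subtractf)

lemma matrix_diff_rdistrib: "(N - P) ** M = N ** M - P ** M" for M :: "'r::ring_1^'n^'m"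
  by (simp add: matrix_matrix_mult_def vec_eq_iff left_diff_distrib sum_subtractf)

lemma even_or_odd_nat:
  fixes k :: nat
  obtains k' where "k = 2 * k'" | k' where "k = Suc (2 * k')"
  by (metis evenE oddE Suc_eq_plus1)

text \<open>For even \<open>k\<close> a factor \<open>A 1\<close> is added. For odd \<open>k\<close>
  it is already there, and Cayley-Hamilton applies to the square; passing from odd \<open>k\<close>
  to \<open>k + 1\<close> exchanges the factor \<open>A 1\<close> for a determinant.\<close>

lemma trace_basis_mult_1:
  "A 1 ** trace_basis (m, i, j, k, l) A =
    (if even k then trace_basis (m, i, j, k + 1, l) A
     else trace_basis (m, i + 1, j, k, l) A - trace_basis (m, i, j, k + 1, l) A)"
proof -
  have *: "A 1 ** (A 1 ** N) = mat (trace (A 1)) ** (A 1 ** N) - mat (det (A 1)) ** N" for N :: "'a^2^2"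
    by (simp only: matrix_mul_assoc square_2 matrix_diff_rdistrib)
  show ?thesis
    by (cases k rule: even_or_odd_nat)
      (simp_all add: trace_basis_def mult_mat_assoc[of "A 1"] * matrix_diff_ldistrib mat_mat_mult,
        simp_all add: mult_ac)
qed

text \<open>The four parities of \<open>(k, l)\<close> are the products of \<open>A 2\<close> with
  1, B, A and A B. The index \<open>k - 1\<close> occurs only for odd \<open>k\<close>, where it
  removes the factor \<open>A 1\<close>.\<close>

lemma trace_basis_mult_2:
  "A 2 ** trace_basis (m, i, j, k, l) A =
    (if even k then
       (if even l then trace_basis (m, i, j, k, l + 1) A
        else trace_basis (m, i, j + 1, k, l) A - trace_basis (m, i, j, k, l + 1) A)
     else if even l then
       trace_basis (m, i, j + 1, k, l) A + trace_basis (m, i + 1, j, k - 1, l + 1) A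
       - trace_basis (m, i, j, k, l + 1) A - trace_basis (m + 1, i, j, k - 1, l) A
     else
       trace_basis (m, i, j, k, l + 1) A + trace_basis (m, i + 1, j + 1, k - 1, l) A
       - trace_basis (m, i + 1, j, k - 1, l + 1) A - trace_basis (m + 1, i, j, k - 1, l) A)"
  by (cases k rule: even_or_odd_nat; cases l rule: even_or_odd_nat)
    (simp_all add: trace_basis_def mult_mat_assoc[of "A 2"] square_2 swap_2 left_mult_121
      matrix_mult_mat[of "A 2"] matrix_diff_ldistrib matrix_add_ldistrib mat_mat_mult mat_mult_mat,
      simp_all add: mult_ac)

lemma trace_basis_mult_trace:
  "mat (trace (A 1)) ** trace_basis (m, i, j, k, l) A = trace_basis (m, i + 1, j, k, l) A"
  "mat (trace (A 2)) ** trace_basis (m, i, j, k, l) A = trace_basis (m, i, j + 1, k, l) A"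
  by (simp_all add: trace_basis_def mat_mat_mult mult_ac)


section \<open>Spans of words in two matrices\<close>

definition matrix_scale :: "complex \<Rightarrow> 'v mpoly^'m^'m \<Rightarrow> 'v mpoly^'m^'m" where
  "matrix_scale c M = mat (mpoly_const c) ** M"

interpretation matrix: vector_space matrix_scale
  by unfold_locales
    (simp_all add: matrix_scale_def matrix_add_ldistrib mpoly_const_add mat_add
      matrix_mult_add_left matrix_mul_assoc mat_mult_mat mpoly_const_mult)

lemma span_mult_left:
  fixes P :: "'v mpoly^'m^'m"
  assumes "x \<in> matrix.span X" "\<And>y. y \<in> X \<Longrightarrow> P ** y \<in> matrix.span Z"
  shows "P ** x \<in> matrix.span Z"
  using assms(1)
proof (induction rule: matrix.span_induct_alt)
  case (step c y x)
  have "P ** (matrix_scale c y + x) = matrix_scale c (P ** y) + P ** x"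
    by (simp add: matrix_scale_def matrix_add_ldistrib mult_mat_assoc)
  then show ?case using step assms(2) by (simp add: matrix.span_add matrix.span_scale)
qed (simp add: matrix.span_zero)

lemma span_mult_right:
  fixes P :: "'v mpoly^'m^'m"
  assumes "x \<in> matrix.span X" "\<And>y. y \<in> X \<Longrightarrow> y ** P \<in> matrix.span Z"
  shows "x ** P \<in> matrix.span Z"
  using assms(1)
proof (induction rule: matrix.span_induct_alt)
  case (step c y x)
  have "(matrix_scale c y + x) ** P = matrix_scale c (y ** P) + x ** P"
    by (simp add: matrix_scale_def matrix_mult_add_left matrix_mul_assoc)
  then show ?case using step assms(2) by (simp add: matrix.span_add matrix.span_scale)
qed (simp add: matrix.span_zero)

section \<open>Spans of words, of trace monomials and of products with adjugate words, in a fixed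
  bidegree\<close>

definition word_span :: "(2 \<Rightarrow> 'v mpoly^2^2) \<Rightarrow> nat \<Rightarrow> nat \<Rightarrow> ('v mpoly^2^2) set" where
  "word_span A p q = matrix.span (word_prod A ` {w. count_list w 1 = p \<and> count_list w 2 = q})"

definition trace_span :: "(2 \<Rightarrow> 'v mpoly^2^2) \<Rightarrow> nat \<Rightarrow> nat \<Rightarrow> ('v mpoly^2^2) set" where
  "trace_span A p q =
     matrix.span ((\<lambda>t. trace_basis t A) ` {t. trace_degree1 t = p \<and> trace_degree2 t = q})"

definition mixed_span :: "(2 \<Rightarrow> 'v mpoly^2^2) \<Rightarrow> nat \<Rightarrow> nat \<Rightarrow> ('v mpoly^2^2) set" where
  "mixed_span A p q = matrix.span ((\<lambda>(u, v). word_prod A u ** word_prod (\<lambda>i. adj2 (A i)) v) `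
     {(u, v). count_list (u @ v) 1 = p \<and> count_list (u @ v) 2 = q})"

lemma count_list_replicate: "count_list (replicate n x) y = (if x = y then n else 0)"
  by (induction n) auto

lemma mixed_span_base:
  assumes "count_list (u @ v) 1 = p" "count_list (u @ v) 2 = q"
  shows "word_prod A u ** word_prod (\<lambda>i. adj2 (A i)) v \<in> mixed_span A p q"
  unfolding mixed_span_def using assms by (intro matrix.span_base) force

text \<open>Plain letters may be added only on the left and adjugate letters only on the right,
  since the two kinds of factors stay in this order.\<close>

lemma mixed_span_sandwich:
  assumes z: "z \<in> mixed_span A a b"
    and p: "count_list (u @ v) 1 + a = p" and q: "count_list (u @ v) 2 + b = q"
  shows "word_prod A u ** z ** word_prod (\<lambda>i. adj2 (A i)) v \<in> mixed_span A p q"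
proof -
  have "word_prod A u ** z \<in> mixed_span A (count_list u 1 + a) (count_list u 2 + b)"
    unfolding mixed_span_def
  proof (rule span_mult_left[OF z[unfolded mixed_span_def]], clarify)
    fix s t :: "2 list"
    show "word_prod A u ** (word_prod A s ** word_prod (\<lambda>i. adj2 (A i)) t) \<in>
      matrix.span ((\<lambda>(u, v). word_prod A u ** word_prod (\<lambda>i. adj2 (A i)) v) `
        {(u', v). count_list (u' @ v) 1 = count_list u 1 + count_list (s @ t) 1 \<and>
          count_list (u' @ v) 2 = count_list u 2 + count_list (s @ t) 2})"
      using mixed_span_base[of "u @ s" t _ _ A, OF refl refl]
      by (simp add: mixed_span_def word_prod_append matrix_mul_assoc add.assoc)
  qed
  then show ?thesis
    unfolding mixed_span_def
  proof (rule span_mult_right, clarify)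
    fix s t :: "2 list"
    assume st: "count_list (s @ t) 1 = count_list u 1 + a" "count_list (s @ t) 2 = count_list u 2 + b"
    show "word_prod A s ** word_prod (\<lambda>i. adj2 (A i)) t ** word_prod (\<lambda>i. adj2 (A i)) v \<in>
      matrix.span ((\<lambda>(u, v). word_prod A u ** word_prod (\<lambda>i. adj2 (A i)) v) `
        {(u, v). count_list (u @ v) 1 = p \<and> count_list (u @ v) 2 = q})"
      using mixed_span_base[of s "t @ v" p q A] st p q
      by (simp add: mixed_span_def word_prod_append matrix_mul_assoc)
  qed
qed

text \<open>A scalar matrix can be moved between the plain and the adjugate factor, where its own
  expansion merges with both of them.\<close>

lemma mixed_span_mult_central:
  assumes x: "x \<in> mixed_span A p q" and c: "mat c \<in> mixed_span A a b"
  shows "mat c ** x \<in> mixed_span A (a + p) (b + q)"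
  unfolding mixed_span_def
proof (rule span_mult_left[OF x[unfolded mixed_span_def]], clarify)
  fix u v :: "2 list"
  assume "p = count_list (u @ v) 1" "q = count_list (u @ v) 2"
  have "mat c ** (word_prod A u ** word_prod (\<lambda>i. adj2 (A i)) v) =
      word_prod A u ** mat c ** word_prod (\<lambda>i. adj2 (A i)) v"
    by (simp add: mult_mat_assoc matrix_mul_assoc matrix_mult_mat)
  then show "mat c ** (word_prod A u ** word_prod (\<lambda>i. adj2 (A i)) v) \<in>
      matrix.span ((\<lambda>(u, v). word_prod A u ** word_prod (\<lambda>i. adj2 (A i)) v) `
        {(u', v'). count_list (u' @ v') 1 = a + count_list (u @ v) 1 \<and>
          count_list (u' @ v') 2 = b + count_list (u @ v) 2})"
    using mixed_span_sandwich[OF c, of u v] by (simp add: mixed_span_def add.commute)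
qed

lemma one_in_mixed_span: "mat 1 \<in> mixed_span A 0 0"
  using mixed_span_base[of "[]" "[]" 0 0 A] by simp

lemma power_in_mixed_span:
  "mat c \<in> mixed_span A a b \<Longrightarrow> mat (c ^ n) \<in> mixed_span A (n * a) (n * b)"
proof (induction n)
  case (Suc n)
  then show ?case
    using mixed_span_mult_central[of "mat (c ^ n)" A "n * a" "n * b" c a b] by (simp add: mat_mult_mat)
qed (simp add: one_in_mixed_span)

lemma mult_in_mixed_span:
  assumes "mat c \<in> mixed_span A a b" "mat e \<in> mixed_span A a' b'"
  shows "mat (c * e) \<in> mixed_span A (a + a') (b + b')"
  using mixed_span_mult_central[OF assms(2,1)] by (simp add: mat_mult_mat)

lemma invariants_in_mixed_span:
  "mat (trace (A 1)) \<in> mixed_span A 1 0" "mat (trace (A 2)) \<in> mixed_span A 0 1"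
  "mat (det (A 1)) \<in> mixed_span A 2 0" "mat (det (A 2)) \<in> mixed_span A 0 2"
  "mat (mixed_trace A) \<in> mixed_span A 1 1"
proof -
  note base = mixed_span_base[of _ _ _ _ A]
  have "mat (trace (A i)) = A i + adj2 (A i)" for i
    by (simp add: adj2_def)
  then show "mat (trace (A 1)) \<in> mixed_span A 1 0" "mat (trace (A 2)) \<in> mixed_span A 0 1"
    using base[of "[1]" "[]" 1 0] base[of "[]" "[1]" 1 0] base[of "[2]" "[]" 0 1] base[of "[]" "[2]" 0 1]
    by (simp_all add: mixed_span_def matrix.span_add)
  show "mat (det (A 1)) \<in> mixed_span A 2 0" "mat (det (A 2)) \<in> mixed_span A 0 2"
    using base[of "[1]" "[1]" 2 0] base[of "[2]" "[2]" 0 2] by (simp_all add: mult_adj2)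
  show "mat (mixed_trace A) \<in> mixed_span A 1 1"
    using base[of "[1]" "[2]" 1 1] base[of "[2]" "[1]" 1 1]
    by (simp add: mixed_span_def matrix.span_add mult_adj2_mixed[symmetric])
qed

lemma trace_basis_in_mixed_span:
  "trace_basis t A \<in> mixed_span A (trace_degree1 t) (trace_degree2 t)"
proof -
  obtain m i j k l where t: "t = (m, i, j, k, l)" by (rule prod_cases5)
  \<comment> \<open>The bidegrees are left unsimplified, in the shape in which the product and power
    rules produce them.\<close>
  have "mat (trace_coeff t A) \<in> mixed_span A
      (m * 1 + (i * 1 + (j * 0 + ((k div 2) * 2 + (l div 2) * 0))))
      (m * 1 + (i * 0 + (j * 1 + ((k div 2) * 0 + (l div 2) * 2))))"
    unfolding t trace_coeff.simps
    by (intro mult_in_mixed_span power_in_mixed_span invariants_in_mixed_span)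
  moreover have "word_prod A (trace_word t) \<in> mixed_span A (k mod 2) (l mod 2)"
    using mixed_span_base[of "trace_word t" "[]" "k mod 2" "l mod 2" A]
    by (simp add: t count_list_replicate)
  ultimately have "trace_basis t A \<in> mixed_span A
      ((m * 1 + (i * 1 + (j * 0 + ((k div 2) * 2 + (l div 2) * 0)))) + k mod 2)
      ((m * 1 + (i * 0 + (j * 1 + ((k div 2) * 0 + (l div 2) * 2)))) + l mod 2)"
    unfolding trace_basis_def by (intro mixed_span_mult_central)
  then show ?thesis by (simp add: t add_ac)
qed

text \<open>The summand \<open>Inl\<close> represents the quotient by the commutator ideal, that is,
  the commutative polynomials; the summand \<open>Inr\<close> represents the ideal itself.\<close>

fun basis_elem :: "(nat \<times> nat) + trace_index \<Rightarrow> (2 \<Rightarrow> 'r::comm_ring_1^2^2) \<Rightarrow> 'r^2^2" where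
  "basis_elem (Inl (p, q)) A = word_prod A (replicate p 1 @ replicate q 2)"
| "basis_elem (Inr t) A = trace_basis t A ** commutator A"

definition basis_index :: "nat \<Rightarrow> nat \<Rightarrow> ((nat \<times> nat) + trace_index) set" where
  "basis_index p q =
     insert (Inl (p, q)) (Inr ` {t. Suc (trace_degree1 t) = p \<and> Suc (trace_degree2 t) = q})"

text \<open>Moving the commutator Y to the left turns u v* Y into u Y v, a difference of two
  words.\<close>

lemma mixed_span_mult_commutator:
  assumes "x \<in> mixed_span A p q"
  shows "x ** commutator A \<in> word_span A (Suc p) (Suc q)"
  unfolding word_span_def
proof (rule span_mult_right[OF assms[unfolded mixed_span_def]], clarify)
  fix u v :: "2 list"
  let ?W = "{w :: 2 list. count_list w 1 = Suc (count_list (u @ v) 1) \<and>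
    count_list w 2 = Suc (count_list (u @ v) 2)}"
  have "word_prod A u ** word_prod (\<lambda>i. adj2 (A i)) v ** commutator A =
      word_prod A u ** (commutator A ** word_prod A v)"
    by (simp add: commutator_word_prod matrix_mul_assoc)
  also have "\<dots> = word_prod A (u @ [1, 2] @ v) - word_prod A (u @ [2, 1] @ v)"
    by (simp add: commutator_def word_prod_append matrix_diff_ldistrib matrix_diff_rdistrib
        matrix_mul_assoc)
  also have "\<dots> \<in> matrix.span (word_prod A ` ?W)"
    by (intro matrix.span_diff matrix.span_base imageI) auto
  finally show "word_prod A u ** word_prod (\<lambda>i. adj2 (A i)) v ** commutator A
    \<in> matrix.span (word_prod A ` ?W)" .
qed

lemma basis_elem_in_word_span:
  "b \<in> basis_index p q \<Longrightarrow> basis_elem b A \<in> word_span A p q"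
proof (cases b)
  case (Inl pq)
  assume "b \<in> basis_index p q"
  with Inl show ?thesis
    by (auto simp: basis_index_def word_span_def count_list_replicate intro!: matrix.span_base imageI)
next
  case (Inr t)
  assume "b \<in> basis_index p q"
  with Inr mixed_span_mult_commutator[OF trace_basis_in_mixed_span, of t A] show ?thesis
    by (auto simp: basis_index_def)
qed

section \<open>Stability of the trace spans under letters and adjugates\<close>

lemma trace_basis_in_trace_span:
  "trace_degree1 t = p \<Longrightarrow> trace_degree2 t = q \<Longrightarrow> trace_basis t A \<in> trace_span A p q"
  by (auto simp: trace_span_def intro!: matrix.span_base)

lemma trace_span_mult:
  assumes "x \<in> trace_span A p q"
    and "\<And>t. trace_degree1 t = p \<Longrightarrow> trace_degree2 t = q \<Longrightarrow>
      P ** trace_basis t A \<in> trace_span A p' q'"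
  shows "P ** x \<in> trace_span A p' q'"
  using assms(2) unfolding trace_span_def
  by (intro span_mult_left[OF assms(1)[unfolded trace_span_def]]) auto

lemma trace_span_add: "x \<in> trace_span A p q \<Longrightarrow> y \<in> trace_span A p q \<Longrightarrow> x + y \<in> trace_span A p q"
  and trace_span_diff: "x \<in> trace_span A p q \<Longrightarrow> y \<in> trace_span A p q \<Longrightarrow> x - y \<in> trace_span A p q"
  by (simp_all add: trace_span_def matrix.span_add matrix.span_diff)

lemma trace_span_mult_letter:
  assumes x: "x \<in> trace_span A p q"
  shows "A 1 ** x \<in> trace_span A (Suc p) q" "A 2 ** x \<in> trace_span A p (Suc q)"
proof -
  show "A 1 ** x \<in> trace_span A (Suc p) q"
  proof (rule trace_span_mult[OF x])
    fix t assume "trace_degree1 t = p" "trace_degree2 t = q"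
    then show "A 1 ** trace_basis t A \<in> trace_span A (Suc p) q"
      by (cases t rule: prod_cases5) (auto simp: trace_basis_mult_1
          intro!: trace_span_add trace_span_diff trace_basis_in_trace_span)
  qed
  show "A 2 ** x \<in> trace_span A p (Suc q)"
  proof (rule trace_span_mult[OF x])
    fix t assume "trace_degree1 t = p" "trace_degree2 t = q"
    then show "A 2 ** trace_basis t A \<in> trace_span A p (Suc q)"
      by (cases t rule: prod_cases5) (auto simp: trace_basis_mult_2
          intro!: trace_span_add trace_span_diff trace_basis_in_trace_span elim!: oddE)
  qed
qed

lemma trace_span_mult_adj:
  assumes x: "x \<in> trace_span A p q"
  shows "adj2 (A 1) ** x \<in> trace_span A (Suc p) q" "adj2 (A 2) ** x \<in> trace_span A p (Suc q)"
proof -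
  have "mat (trace (A 1)) ** x \<in> trace_span A (Suc p) q"
  proof (rule trace_span_mult[OF x])
    fix t assume "trace_degree1 t = p" "trace_degree2 t = q"
    then show "mat (trace (A 1)) ** trace_basis t A \<in> trace_span A (Suc p) q"
      by (cases t rule: prod_cases5)
        (auto simp: trace_basis_mult_trace intro!: trace_basis_in_trace_span)
  qed
  then show "adj2 (A 1) ** x \<in> trace_span A (Suc p) q"
    using trace_span_mult_letter[OF x] by (simp add: adj2_def matrix_diff_rdistrib trace_span_diff)
  have "mat (trace (A 2)) ** x \<in> trace_span A p (Suc q)"
  proof (rule trace_span_mult[OF x])
    fix t assume "trace_degree1 t = p" "trace_degree2 t = q"
    then show "mat (trace (A 2)) ** trace_basis t A \<in> trace_span A p (Suc q)"
      by (cases t rule: prod_cases5)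
        (auto simp: trace_basis_mult_trace intro!: trace_basis_in_trace_span)
  qed
  then show "adj2 (A 2) ** x \<in> trace_span A p (Suc q)"
    using trace_span_mult_letter[OF x] by (simp add: adj2_def matrix_diff_rdistrib trace_span_diff)
qed

text \<open>Adjugate words are what remains on the left when the commutator is moved to the end of a
  word, so they must be expanded in trace monomials.\<close>

lemma adj_word_prod_in_trace_span:
  "word_prod (\<lambda>i. adj2 (A i)) w \<in> trace_span A (count_list w 1) (count_list w 2)"
proof (induction w)
  case Nil
  have "mat 1 = trace_basis (0, 0, 0, 0, 0) A" by (simp add: trace_basis_def)
  also have "\<dots> \<in> trace_span A 0 0" by (rule trace_basis_in_trace_span) simp_all
  finally show ?case by simp
next
  case (Cons i w)
  have "i = 1 \<or> i = 2" by (rule exhaust_2)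
  with trace_span_mult_adj[OF Cons] show ?case by auto
qed

section \<open>Expansion of words in the explicit basis\<close>

definition basis_span :: "(2 \<Rightarrow> 'v mpoly^2^2) \<Rightarrow> nat \<Rightarrow> nat \<Rightarrow> ('v mpoly^2^2) set" where
  "basis_span A p q = matrix.span ((\<lambda>b. basis_elem b A) ` basis_index p q)"

lemma basis_elem_in_basis_span: "b \<in> basis_index p q \<Longrightarrow> basis_elem b A \<in> basis_span A p q"
  by (simp add: basis_span_def matrix.span_base)

lemma trace_span_mult_commutator:
  "x \<in> trace_span A p q \<Longrightarrow> x ** commutator A \<in> basis_span A (Suc p) (Suc q)"
  unfolding basis_span_def trace_span_def
  by (erule span_mult_right)
    (auto intro!: matrix.span_base image_eqI[of _ _ "Inr _"] simp: basis_index_def)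

lemma ordered_word_in_basis_span:
  "word_prod A (replicate p 1 @ replicate q 2) \<in> basis_span A p q"
  using basis_elem_in_basis_span[of "Inl (p, q)" p q A] by (simp add: basis_index_def)

lemma basis_span_mult:
  assumes x: "x \<in> basis_span A p q"
    and word: "P ** word_prod A (replicate p 1 @ replicate q 2) \<in> basis_span A p' q'"
    and trace: "\<And>t. Suc (trace_degree1 t) = p \<Longrightarrow> Suc (trace_degree2 t) = q \<Longrightarrow>
      P ** trace_basis t A ** commutator A \<in> basis_span A p' q'"
  shows "P ** x \<in> basis_span A p' q'"
  unfolding basis_span_def
proof (rule span_mult_left[OF x[unfolded basis_span_def]])
  fix y assume "y \<in> (\<lambda>b. basis_elem b A) ` basis_index p q"
  then show "P ** y \<in> matrix.span ((\<lambda>b. basis_elem b A) ` basis_index p' q')"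
    using word trace by (auto simp: basis_index_def basis_span_def matrix_mul_assoc)
qed

lemma basis_span_mult_1:
  assumes x: "x \<in> basis_span A p q"
  shows "A 1 ** x \<in> basis_span A (Suc p) q"
proof (rule basis_span_mult[OF x])
  show "A 1 ** word_prod A (replicate p 1 @ replicate q 2) \<in> basis_span A (Suc p) q"
    using ordered_word_in_basis_span[of A "Suc p" q] by simp
  fix t assume "Suc (trace_degree1 t) = p" "Suc (trace_degree2 t) = q"
  then show "A 1 ** trace_basis t A ** commutator A \<in> basis_span A (Suc p) q"
    using trace_span_mult_commutator[OF trace_span_mult_letter(1)[OF trace_basis_in_trace_span]]
    by blast
qed

text \<open>The letter B is moved past one A at a time: B A w = A (B w) - Y w, and Y w = w* Y lies
  in the ideal part.\<close>

lemma mult_2_ordered_word: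
  "A 2 ** word_prod A (replicate p 1 @ replicate q 2) \<in> basis_span A p (Suc q)"
proof (induction p)
  case 0
  then show ?case using ordered_word_in_basis_span[of A 0 "Suc q"] by simp
next
  case (Suc p)
  let ?w = "replicate p 1 @ replicate q 2 :: 2 list"
  have "A 2 ** word_prod A (1 # ?w) = A 1 ** (A 2 ** word_prod A ?w)
      - word_prod (\<lambda>i. adj2 (A i)) ?w ** commutator A"
    unfolding commutator_word_prod[symmetric]
    by (simp add: commutator_def matrix_diff_rdistrib matrix_mul_assoc)
  moreover have "word_prod (\<lambda>i. adj2 (A i)) ?w ** commutator A \<in> basis_span A (Suc p) (Suc q)"
    using adj_word_prod_in_trace_span[of A ?w]
    by (intro trace_span_mult_commutator) (simp add: count_list_replicate)
  ultimately show ?case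
    using basis_span_mult_1[OF Suc.IH] by (simp add: basis_span_def matrix.span_diff)
qed

lemma basis_span_mult_2:
  assumes x: "x \<in> basis_span A p q"
  shows "A 2 ** x \<in> basis_span A p (Suc q)"
proof (rule basis_span_mult[OF x mult_2_ordered_word])
  fix t assume "Suc (trace_degree1 t) = p" "Suc (trace_degree2 t) = q"
  then show "A 2 ** trace_basis t A ** commutator A \<in> basis_span A p (Suc q)"
    using trace_span_mult_commutator[OF trace_span_mult_letter(2)[OF trace_basis_in_trace_span]]
    by blast
qed

lemma word_prod_in_basis_span: "word_prod A w \<in> basis_span A (count_list w 1) (count_list w 2)"
proof (induction w)
  case Nil
  show ?case using ordered_word_in_basis_span[of A 0 0] by simp
next
  case (Cons i w)
  have "i = 1 \<or> i = 2" by (rule exhaust_2)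
  with basis_span_mult_1[OF Cons] basis_span_mult_2[OF Cons] show ?case by auto
qed

lemma word_span_eq_basis_span: "word_span A p q = basis_span A p q"
proof (rule subset_antisym)
  show "word_span A p q \<subseteq> basis_span A p q"
    unfolding word_span_def
  proof (rule matrix.span_minimal)
    show "word_prod A ` {w. count_list w 1 = p \<and> count_list w 2 = q} \<subseteq> basis_span A p q"
      using word_prod_in_basis_span by blast
    show "matrix.subspace (basis_span A p q)" unfolding basis_span_def by (rule matrix.subspace_span)
  qed
  show "basis_span A p q \<subseteq> word_span A p q"
    unfolding basis_span_def
  proof (rule matrix.span_minimal)
    show "(\<lambda>b. basis_elem b A) ` basis_index p q \<subseteq> word_span A p q"
      using basis_elem_in_word_span by blast
    show "matrix.subspace (word_span A p q)" unfolding word_span_def by (rule matrix.subspace_span)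
  qed
qed


section \<open>Linear independence\<close>

lemma power_sum_eq_0:
  fixes c :: "nat \<Rightarrow> complex"
  assumes J: "finite J" and X: "infinite X" and eq: "\<And>x. x \<in> X \<Longrightarrow> (\<Sum>i\<in>J. x ^ i * c i) = 0"
  shows "\<forall>i\<in>J. c i = 0"
proof -
  define p where "p = (\<Sum>i\<in>J. monom (c i) i)"
  have "X \<subseteq> {x. poly p x = 0}"
    using eq by (auto simp: p_def poly_sum poly_monom mult.commute)
  then have "infinite {x. poly p x = 0}" using X finite_subset by blast
  then have "p = 0" using poly_roots_finite by blast
  moreover have "poly.coeff p i = c i" if "i \<in> J" for i
    using that J by (simp add: p_def coeff_sum)
  ultimately show ?thesis by simp
qed

lemma finite_section: "finite J \<Longrightarrow> finite (J `` {i})"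
  by (rule finite_subset[of _ "snd ` J"]) force+

text \<open>Collecting equal powers of \<open>x\<close> gives a polynomial whose coefficients are
  sums over sections of \<open>J\<close>. This removes one variable at a time although the remaining
  support depends on \<open>i\<close>.\<close>

lemma power_sum_eq_0_Sigma:
  fixes g :: "nat \<Rightarrow> 'b \<Rightarrow> complex"
  assumes J: "finite J" and X: "infinite X"
    and eq: "\<And>x. x \<in> X \<Longrightarrow> (\<Sum>(i, u)\<in>J. x ^ i * g i u) = 0"
  shows "(\<Sum>u\<in>J `` {i}. g i u) = 0"
proof (cases "i \<in> fst ` J")
  case True
  have J_eq: "J = Sigma (fst ` J) (\<lambda>i. J `` {i})" by force
  have "(\<Sum>i\<in>fst ` J. x ^ i * (\<Sum>u\<in>J `` {i}. g i u)) = 0" if "x \<in> X" for x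
  proof -
    have "(\<Sum>i\<in>fst ` J. x ^ i * (\<Sum>u\<in>J `` {i}. g i u))
        = (\<Sum>(i, u)\<in>Sigma (fst ` J) (\<lambda>i. J `` {i}). x ^ i * g i u)"
      using J by (simp add: sum_distrib_left sum.Sigma finite_section)
    then show ?thesis using eq[OF that] J_eq by simp
  qed
  from power_sum_eq_0[OF finite_imageI[OF J] X this] True show ?thesis by blast
next
  case False
  then have "J `` {i} = {}" by force
  then show ?thesis by simp
qed

lemma monomials2_independent:
  fixes c :: "nat \<times> nat \<Rightarrow> complex"
  assumes J: "finite J" and eq: "\<And>x y. (\<Sum>(i, j)\<in>J. x ^ i * (y ^ j * c (i, j))) = 0"
  shows "\<forall>t\<in>J. c t = 0"
proof clarify
  fix i j assume "(i, j) \<in> J"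
  have "(\<Sum>j\<in>J `` {i}. y ^ j * c (i, j)) = 0" for y
    by (rule power_sum_eq_0_Sigma[OF J infinite_UNIV_char_0 eq])
  from power_sum_eq_0[OF finite_section[OF J] infinite_UNIV_char_0 this]
  show "c (i, j) = 0" using \<open>(i, j) \<in> J\<close> by blast
qed

text \<open>The range of \<open>v\<close> depends on the other four values, so \<open>v\<close> is
  eliminated first; afterwards the others vary freely.\<close>

lemma monomials5_independent:
  fixes c :: "trace_index \<Rightarrow> complex" and X :: "complex \<Rightarrow> complex \<Rightarrow> complex \<Rightarrow> complex \<Rightarrow> complex set"
  assumes J: "finite J" and X: "\<And>x y z w. infinite (X x y z w)"
    and eq: "\<And>x y z w v. v \<in> X x y z w \<Longrightarrow>
      (\<Sum>(m, i, j, k, l)\<in>J. v ^ m * (x ^ i * (y ^ j * (z ^ k * (w ^ l * c (m, i, j, k, l)))))) = 0"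
  shows "\<forall>t\<in>J. c t = 0"
proof clarify
  fix m i j k l assume t: "(m, i, j, k, l) \<in> J"
  note step = power_sum_eq_0_Sigma and inf = infinite_UNIV_char_0[where 'a = complex]
  let ?J1 = "J `` {m}" let ?J2 = "?J1 `` {i}" let ?J3 = "?J2 `` {j}" let ?J4 = "?J3 `` {k}"
  have fin: "finite ?J1" "finite ?J2" "finite ?J3" "finite ?J4"
    using J by (simp_all add: finite_section)
  have 1: "(\<Sum>(i, j, k, l)\<in>?J1. x ^ i * (y ^ j * (z ^ k * (w ^ l * c (m, i, j, k, l))))) = 0" for x y z w
    using step[OF J X[of x y z w], where i = m and g =
        "\<lambda>m (i, j, k, l). x ^ i * (y ^ j * (z ^ k * (w ^ l * c (m, i, j, k, l))))"] eq[of _ x y z w]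
    by (simp add: case_prod_unfold)
  have 2: "(\<Sum>(j, k, l)\<in>?J2. y ^ j * (z ^ k * (w ^ l * c (m, i, j, k, l)))) = 0" for y z w
    using step[OF fin(1) inf, where i = i and g =
        "\<lambda>i (j, k, l). y ^ j * (z ^ k * (w ^ l * c (m, i, j, k, l)))"] 1[of _ y z w]
    by (simp add: case_prod_unfold)
  have 3: "(\<Sum>(k, l)\<in>?J3. z ^ k * (w ^ l * c (m, i, j, k, l))) = 0" for z w
    using step[OF fin(2) inf, where i = j and g =
        "\<lambda>j (k, l). z ^ k * (w ^ l * c (m, i, j, k, l))"] 2[of _ z w]
    by (simp add: case_prod_unfold)
  have "\<forall>t\<in>?J3. c (m, i, j, t) = 0"
    by (rule monomials2_independent[OF fin(3)]) (use 3 in \<open>simp add: case_prod_unfold\<close>)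
  with t show "c (m, i, j, k, l) = 0" by blast
qed

section \<open>Matrix pairs with invertible commutator\<close>

lemma mat_sum: "mat (\<Sum>i\<in>I. f i) = (\<Sum>i\<in>I. mat (f i) :: 'r::semiring_1^'m^'m)"
  by (induction I rule: infinite_finite_induct) (simp_all add: mat_add mat_def vec_eq_iff)

lemma mat_eq_0_iff: "(mat c :: 'r::semiring_1^'m^'m) = 0 \<longleftrightarrow> c = 0"
  by (auto simp: mat_def vec_eq_iff)

lemma matrix_mult_cancel_right:
  fixes M N :: "complex^2^2"
  assumes "det N \<noteq> 0" "M ** N = 0"
  shows "M = 0"
proof -
  have "M ** N ** adj2 N = mat (det N) ** M"
    by (simp add: matrix_mul_assoc[symmetric] mult_adj2 matrix_mult_mat)
  then have "mat (det N) ** M = 0" using assms(2) by simp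
  then show ?thesis using assms(1) by (simp add: mat_matrix_mult vec_eq_iff)
qed

text \<open>Taking the commutator with \<open>A 2\<close> kills the scalar part and leaves q Y,
  where Y is invertible.\<close>

lemma noncentral_matrix_independent:
  fixes A :: "2 \<Rightarrow> complex^2^2"
  assumes Y: "det (commutator A) \<noteq> 0" and eq: "mat p + mat q ** A 1 = 0"
  shows "p = 0 \<and> q = 0"
proof -
  have "mat q ** commutator A = (mat p + mat q ** A 1) ** A 2 - A 2 ** (mat p + mat q ** A 1)"
    by (simp add: commutator_def matrix_diff_ldistrib matrix_mult_add_left matrix_add_ldistrib
        mult_mat_assoc[of "A 2"] matrix_mult_mat[of "A 2"] matrix_mul_assoc)
  also have "\<dots> = 0" by (simp add: eq)
  finally have "q = 0" using matrix_mult_cancel_right[OF Y] mat_eq_0_iff by blast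
  with eq show ?thesis by (simp add: mat_eq_0_iff)
qed

text \<open>Taking the commutator with \<open>A 1\<close> reduces the claim to the independence of \<open>1\<close> and \<open>A 1\<close>.\<close>

lemma matrix_quadruple_independent:
  fixes A :: "2 \<Rightarrow> complex^2^2"
  assumes Y: "det (commutator A) \<noteq> 0"
    and eq: "mat p + mat q ** A 1 + mat r ** A 2 + mat s ** (A 1 ** A 2) = 0"
  shows "p = 0 \<and> q = 0 \<and> r = 0 \<and> s = 0"
proof -
  let ?M = "mat p + mat q ** A 1 + mat r ** A 2 + mat s ** (A 1 ** A 2)"
  have "(mat r + mat s ** A 1) ** commutator A = A 1 ** ?M - ?M ** A 1"
    by (simp add: commutator_def matrix_diff_ldistrib matrix_mult_add_left matrix_add_ldistrib
        mult_mat_assoc[of "A 1"] matrix_mult_mat[of "A 1"] matrix_mul_assoc[symmetric])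
  also have "\<dots> = 0" by (simp add: eq)
  finally have "mat r + mat s ** A 1 = 0" by (rule matrix_mult_cancel_right[OF Y])
  then have rs: "r = 0 \<and> s = 0" by (rule noncentral_matrix_independent[OF Y])
  with eq have "mat p + mat q ** A 1 = 0" by simp
  from noncentral_matrix_independent[OF Y this] rs show ?thesis by simp
qed

text \<open>The numbers \<open>x\<close> and \<open>a - x\<close> serve as the eigenvalues of a
  matrix with trace \<open>a\<close> and determinant \<open>d\<close>.\<close>

lemma quadratic_root_exists: "\<exists>x :: complex. x * (a - x) = d"
proof
  let ?r = "csqrt (a\<^sup>2 - 4 * d)"
  have "?r * ?r = a\<^sup>2 - 4 * d"
    by (metis power2_csqrt power2_eq_square)
  then show "(a + ?r) / 2 * (a - (a + ?r) / 2) = d"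
    by (simp add: field_simps power2_eq_square)
qed

lemma matrices_with_invariants:
  fixes a b d e :: complex
  shows "\<exists>T. finite T \<and> (\<forall>t. t \<notin> T \<longrightarrow> (\<exists>A. trace (A 1) = a \<and> trace (A 2) = b \<and>
    det (A 1) = d \<and> det (A 2) = e \<and> mixed_trace A = t \<and> det (commutator A) \<noteq> 0))"
proof -
  obtain x where x: "x * (a - x) = d" using quadratic_root_exists by blast
  obtain z where z: "z * (b - z) = e" using quadratic_root_exists by blast
  define y w where "y = a - x" and "w = b - z"
  show ?thesis
  proof (intro exI[of _ "{x * w + y * z, x * z + y * w}"] conjI allI impI)
    fix t assume t: "t \<notin> {x * w + y * z, x * z + y * w}"
    \<comment> \<open>An upper triangular matrix with diagonal \<open>x, y\<close> and a lower
      triangular one with diagonal \<open>z, w\<close> and corner \<open>s\<close> have mixed trace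
      \<open>x * w + y * z - s\<close>. The two excluded values of \<open>t\<close> are the zeros of
      the determinant of their commutator.\<close>
    define s where "s = x * w + y * z - t"
    define A :: "2 \<Rightarrow> complex^2^2" where
      "A i = (if i = 1 then vector [vector [x, 1], vector [0, y]]
        else vector [vector [z, 0], vector [s, w]])" for i
    have "det (commutator A) = - (s * (x * z + y * w - t))"
      by (simp add: matrix2_simps A_def s_def algebra_simps)
    then have "det (commutator A) \<noteq> 0" using t by (auto simp: s_def)
    moreover have "trace (A 1) = a" "trace (A 2) = b" "det (A 1) = d" "det (A 2) = e"
      "mixed_trace A = t"
      using x z by (simp_all add: matrix2_simps A_def s_def y_def w_def algebra_simps)
    ultimately show "\<exists>A. trace (A 1) = a \<and> trace (A 2) = b \<and>
      det (A 1) = d \<and> det (A 2) = e \<and> mixed_trace A = t \<and> det (commutator A) \<noteq> 0" by blast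
  qed simp
qed

fun trace_parity :: "trace_index \<Rightarrow> nat \<times> nat" where
  "trace_parity (m, i, j, k, l) = (k mod 2, l mod 2)"

text \<open>Sorting by the parities of \<open>k\<close> and \<open>l\<close> gives the coefficients
  of 1, A, B and A B, which vanish separately. Each is a polynomial in the five invariants, and
  these take all values up to finitely many exceptions for the mixed trace.\<close>

lemma trace_basis_independent:
  assumes J: "finite J"
    and eq: "\<And>A :: 2 \<Rightarrow> complex^2^2. det (commutator A) \<noteq> 0 \<Longrightarrow>
      (\<Sum>t\<in>J. mat (c t) ** trace_basis t A) = 0"
  shows "\<forall>t\<in>J. c t = 0"
proof clarify
  fix m0 i0 j0 k0 l0 assume t0: "(m0, i0, j0, k0, l0) \<in> J"
  have parity: "(\<Sum>t\<in>J. if trace_parity t = rs then c t * trace_coeff t A else 0) = 0"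
    if Y: "det (commutator A) \<noteq> 0" and rs: "rs \<in> {0, 1} \<times> {0, 1}"
    for A :: "2 \<Rightarrow> complex^2^2" and rs
  proof -
    define f where "f rs t = (if trace_parity t = rs then c t * trace_coeff t A else 0)" for rs t
    define P where "P rs = (\<Sum>t\<in>J. f rs t)" for rs
    \<comment> \<open>Only the summand belonging to the parity of \<open>t\<close> is
      nonzero.\<close>
    have split: "mat (c t) ** trace_basis t A = mat (f (0, 0) t) + mat (f (1, 0) t) ** A 1
        + mat (f (0, 1) t) ** A 2 + mat (f (1, 1) t) ** (A 1 ** A 2)" for t
    proof -
      obtain m i j k l where t: "t = (m, i, j, k, l)" by (cases t)
      have "k mod 2 = 0 \<or> k mod 2 = 1" "l mod 2 = 0 \<or> l mod 2 = 1" by auto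
      then show ?thesis
        unfolding t trace_basis_def f_def
        by (elim disjE) (simp_all add: mat_mat_mult mat_mult_mat del: trace_coeff.simps)
    qed
    have "mat (P (0, 0)) + mat (P (1, 0)) ** A 1 + mat (P (0, 1)) ** A 2
        + mat (P (1, 1)) ** (A 1 ** A 2) = (\<Sum>t\<in>J. mat (c t) ** trace_basis t A)"
      unfolding P_def split by (simp add: mat_sum sum.distrib matrix_mult_sum_left)
    then have "P (0, 0) = 0 \<and> P (1, 0) = 0 \<and> P (0, 1) = 0 \<and> P (1, 1) = 0"
      using eq[OF Y] by (intro matrix_quadruple_independent[OF Y]) simp
    then show ?thesis using rs by (auto simp: P_def f_def)
  qed
  define r s where "r = k0 mod 2" and "s = l0 mod 2"
  have rs: "r < 2" "s < 2" by (simp_all add: r_def s_def)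
  \<comment> \<open>Enumerates the indices with parities \<open>(r, s)\<close> by the actual
    exponents of the two determinants.\<close>
  define h :: "trace_index \<Rightarrow> trace_index" where
    "h = (\<lambda>(m, i, j, k, l). (m, i, j, 2 * k + r, 2 * l + s))"
  have inj: "inj h" by (auto simp: h_def inj_on_def)
  have image: "h ` (h -` J) = {t \<in> J. trace_parity t = (r, s)}"
  proof safe
    fix m i j k l assume "(m, i, j, k, l) \<in> J" "trace_parity (m, i, j, k, l) = (r, s)"
    moreover from this have "h (m, i, j, k div 2, l div 2) = (m, i, j, k, l)"
      by (auto simp: h_def)
    ultimately show "(m, i, j, k, l) \<in> h ` (h -` J)" by (metis imageI vimageI)
  qed (use rs in \<open>auto simp: h_def\<close>)
  have "\<forall>x y z w. \<exists>T. finite T \<and> (\<forall>t. t \<notin> T \<longrightarrow> (\<exists>A :: 2 \<Rightarrow> complex^2^2.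
      trace (A 1) = x \<and> trace (A 2) = y \<and> det (A 1) = z \<and> det (A 2) = w \<and> mixed_trace A = t \<and>
      det (commutator A) \<noteq> 0))"
    by (intro allI matrices_with_invariants)
  then obtain T where T: "\<And>x y z w. finite (T x y z w)"
    and ex: "\<And>x y z w t. t \<notin> T x y z w \<Longrightarrow> \<exists>A :: 2 \<Rightarrow> complex^2^2.
      trace (A 1) = x \<and> trace (A 2) = y \<and> det (A 1) = z \<and> det (A 2) = w \<and> mixed_trace A = t \<and>
      det (commutator A) \<noteq> 0"
    by metis
  have "\<forall>t\<in>h -` J. c (h t) = 0"
  proof (rule monomials5_independent[where X = "\<lambda>x y z w. - T x y z w"])
    show "finite (h -` J)" using J inj by (rule finite_vimageI)
    show "infinite (- T x y z w)" for x y z w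
      using T[of x y z w] infinite_UNIV_char_0[where 'a = complex] finite_compl by blast
    fix x y z w v assume "v \<in> - T x y z w"
    then obtain A :: "2 \<Rightarrow> complex^2^2" where A: "trace (A 1) = x" "trace (A 2) = y"
      "det (A 1) = z" "det (A 2) = w" "mixed_trace A = v" "det (commutator A) \<noteq> 0"
      using ex by blast
    have "(\<Sum>(m, i, j, k, l)\<in>h -` J. v ^ m * (x ^ i * (y ^ j * (z ^ k * (w ^ l * c (h (m, i, j, k, l)))))))
        = (\<Sum>u\<in>h -` J. c (h u) * trace_coeff (h u) A)"
      using rs by (intro sum.cong) (auto simp: h_def A)
    also have "\<dots> = (\<Sum>t\<in>{t \<in> J. trace_parity t = (r, s)}. c t * trace_coeff t A)"
      unfolding image[symmetric]
      by (subst sum.reindex[OF inj_on_subset[OF inj subset_UNIV]]) (simp add: comp_def)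
    also have "\<dots> = (\<Sum>t\<in>J. if trace_parity t = (r, s) then c t * trace_coeff t A else 0)"
      using J by (rule sum.inter_filter)
    also have "\<dots> = 0"
      using rs by (intro parity A) auto
    finally show "(\<Sum>(m, i, j, k, l)\<in>h -` J.
      v ^ m * (x ^ i * (y ^ j * (z ^ k * (w ^ l * c (h (m, i, j, k, l))))))) = 0" .
  qed
  moreover have "(m0, i0, j0, k0, l0) \<in> h ` (h -` J)"
    unfolding image using t0 by (simp add: r_def s_def)
  ultimately show "c (m0, i0, j0, k0, l0) = 0" by (metis imageE)
qed

lemma word_prod_replicate_mat:
  "A i = mat x \<Longrightarrow> word_prod A (replicate n i) = (mat (x ^ n) :: 'r::comm_ring_1^'m^'m)"
  by (induction n) (simp_all add: mat_mult_mat)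

lemma basis_elem_independent:
  assumes J: "finite J"
    and eq: "\<And>A :: 2 \<Rightarrow> complex^2^2. (\<Sum>b\<in>J. mat (c b) ** basis_elem b A) = 0"
  shows "\<forall>b\<in>J. c b = 0"
proof -
  define J1 J2 where "J1 = Inl -` J" and "J2 = Inr -` J"
  have fin: "finite J1" "finite J2"
    unfolding J1_def J2_def using J by (simp_all add: finite_vimageI)
  have J_eq: "J = J1 <+> J2"
  proof (rule set_eqI)
    show "b \<in> J \<longleftrightarrow> b \<in> J1 <+> J2" for b by (cases b) (auto simp: J1_def J2_def)
  qed
  have sum: "(\<Sum>t\<in>J1. mat (c (Inl t)) ** basis_elem (Inl t) A) +
      (\<Sum>t\<in>J2. mat (c (Inr t)) ** trace_basis t A) ** commutator A = 0" for A :: "2 \<Rightarrow> complex^2^2"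
    using eq[of A] fin by (simp add: J_eq sum.Plus comp_def matrix_mult_sum_left matrix_mul_assoc)
  have c1: "\<forall>t\<in>J1. c (Inl t) = 0"
  proof (rule monomials2_independent[OF fin(1)])
    fix x y :: complex
    \<comment> \<open>Scalar matrices commute, so the ideal part disappears and the ordered words
      become monomials in \<open>x\<close> and \<open>y\<close>.\<close>
    define A :: "2 \<Rightarrow> complex^2^2" where "A i = (if i = 1 then mat x else mat y)" for i
    have "commutator A = 0" by (simp add: commutator_def A_def mat_mult_mat mult.commute)
    then have "(\<Sum>t\<in>J1. mat (c (Inl t)) ** basis_elem (Inl t) A) = 0" using sum[of A] by simp
    moreover have "mat (c (Inl t)) ** basis_elem (Inl t) A =
        mat (case t of (i, j) \<Rightarrow> x ^ i * (y ^ j * c (Inl (i, j))))" for t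
      by (cases t) (simp add: word_prod_append word_prod_replicate_mat[of A 1 x]
          word_prod_replicate_mat[of A 2 y] A_def mat_mult_mat mult_ac)
    ultimately show "(\<Sum>(i, j)\<in>J1. x ^ i * (y ^ j * c (Inl (i, j)))) = 0"
      by (simp add: mat_sum[symmetric] mat_eq_0_iff)
  qed
  have "\<forall>t\<in>J2. c (Inr t) = 0"
  proof (rule trace_basis_independent[OF fin(2)])
    fix A :: "2 \<Rightarrow> complex^2^2" assume Y: "det (commutator A) \<noteq> 0"
    have "(\<Sum>t\<in>J1. mat (c (Inl t)) ** basis_elem (Inl t) A) = 0"
      using c1 by (intro sum.neutral) (auto simp: mat_matrix_mult vec_eq_iff)
    then show "(\<Sum>t\<in>J2. mat (c (Inr t)) ** trace_basis t A) = 0"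
      using sum[of A] matrix_mult_cancel_right[OF Y] by simp
  qed
  with c1 show ?thesis by (auto simp: J_eq)
qed


section \<open>The basis at generic matrices\<close>

lemma eval_matrix_scale: "eval_matrix x (matrix_scale c M) = mat c ** eval_matrix x M"
  by (simp add: matrix_scale_def eval_matrix_mult eval_matrix_mat)

lemma mpoly_eval_trace: "mpoly_eval (trace M) x = trace (eval_matrix x M)"
  by (simp add: trace_def eval_matrix_def mpoly_eval_sum)

lemma mpoly_eval_det_2: "mpoly_eval (det M) x = det (eval_matrix x M)" for M :: "'v mpoly^2^2"
  by (simp add: det_2 eval_matrix_def mpoly_eval_diff mpoly_eval_mult)

lemma eval_matrix_adj2: "eval_matrix x (adj2 M) = adj2 (eval_matrix x M)"
  by (simp add: adj2_def eval_matrix_diff eval_matrix_mat mpoly_eval_trace)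

lemma mpoly_eval_mixed_trace:
  "mpoly_eval (mixed_trace A) x = mixed_trace (\<lambda>i. eval_matrix x (A i))"
  by (simp add: mixed_trace_def mpoly_eval_trace eval_matrix_mult eval_matrix_adj2)

lemma eval_matrix_trace_basis:
  "eval_matrix x (trace_basis t A) = trace_basis t (\<lambda>i. eval_matrix x (A i))"
  by (cases t) (simp add: trace_basis_def eval_matrix_mult eval_matrix_mat eval_matrix_word_prod
      mpoly_eval_mult mpoly_eval_power mpoly_eval_trace mpoly_eval_det_2 mpoly_eval_mixed_trace)

lemma eval_matrix_basis_elem:
  "eval_matrix x (basis_elem b A) = basis_elem b (\<lambda>i. eval_matrix x (A i))"
proof (cases b)
  case (Inl pq)
  then show ?thesis by (cases pq) (simp add: eval_matrix_word_prod)
next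
  case (Inr t)
  then show ?thesis
    by (simp add: eval_matrix_mult eval_matrix_trace_basis commutator_def eval_matrix_diff)
qed

lemma basis_elem_generic_independent:
  assumes J: "finite J"
    and eq: "(\<Sum>b\<in>J. matrix_scale (c b) (basis_elem b generic_matrix)) = 0"
  shows "\<forall>b\<in>J. c b = 0"
proof (rule basis_elem_independent[OF J])
  fix A :: "2 \<Rightarrow> complex^2^2"
  from arg_cong[OF eq, of "eval_matrix (\<lambda>(i, j, k). A i $ j $ k)"]
  show "(\<Sum>b\<in>J. mat (c b) ** basis_elem b A) = 0"
    by (simp add: eval_matrix_sum eval_matrix_scale eval_matrix_basis_elem eval_generic_matrix)
qed

lemma finite_trace_index: "finite {t. trace_degree1 t = p \<and> trace_degree2 t = q}"
  by (rule finite_subset[of _ "{..p} \<times> {..p} \<times> {..q} \<times> {..p} \<times> {..q}"]) auto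

lemma finite_basis_index: "finite (basis_index p q)"
proof -
  have "finite {t. Suc (trace_degree1 t) = p \<and> Suc (trace_degree2 t) = q}"
    by (rule finite_subset[OF _ finite_trace_index[of "p - 1" "q - 1"]]) auto
  then show ?thesis by (simp add: basis_index_def)
qed


section \<open>The graded components of the ring of generic matrices\<close>

text \<open>Embeds the quotient ring in the polynomial matrices; it is injective by the definition
  of the congruence, so dimensions can be computed among matrices.\<close>

lift_definition generic_value ::
  "('m::finite, 'n::finite) generic_matrix_ring \<Rightarrow> ('n \<times> 'm \<times> 'm) mpoly^'m^'m"
  is "subst_matrices generic_matrix"
  by (simp add: pi_congruent_iff)

lemma generic_value_inject: "generic_value x = generic_value y \<longleftrightarrow> x = y"
  by transfer (simp add: pi_congruent_iff)

lemma generic_value_zero [simp]: "generic_value 0 = 0"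
  by transfer simp

lemma generic_value_add: "generic_value (x + y) = generic_value x + generic_value y"
  by transfer (rule subst_matrices_add)

lemma generic_value_scale:
  "generic_value (generic_matrix_ring_scale c x) = matrix_scale c (generic_value x)"
  by transfer (simp add: subst_matrices_mult subst_matrices_single matrix_scale_def)

lemma generic_value_sum: "generic_value (\<Sum>i\<in>I. x i) = (\<Sum>i\<in>I. generic_value (x i))"
  by (induction I rule: infinite_finite_induct) (simp_all add: generic_value_add)

lemma count_list_eq_iff_2: "count_list w = \<alpha> \<longleftrightarrow> count_list w 1 = \<alpha> 1 \<and> count_list w 2 = \<alpha> 2"
  for \<alpha> :: "2 \<Rightarrow> nat"
  by (simp add: fun_eq_iff forall_2)

lemma length_eq_counts_2: "length w = count_list w 1 + count_list w (2 :: 2)"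
proof (induction w)
  case (Cons i w)
  have "i = 1 \<or> i = 2" by (rule exhaust_2)
  with Cons show ?case by auto
qed simp

lemma finite_words: "finite {w :: 2 list. count_list w 1 = p \<and> count_list w 2 = q}"
  by (rule finite_subset[OF _ finite_lists_length_eq[of "UNIV :: 2 set" "p + q"]])
    (auto simp: length_eq_counts_2)

lemma generic_value_component:
  "generic_value ` (generic_matrix_ring_component \<alpha> :: (2, 2) generic_matrix_ring set) =
     word_span generic_matrix (\<alpha> 1) (\<alpha> 2)"
proof (rule subset_antisym)
  let ?W = "{w :: 2 list. count_list w 1 = \<alpha> 1 \<and> count_list w 2 = \<alpha> 2}"
  let ?G = "generic_matrix :: 2 \<Rightarrow> (2 \<times> 2 \<times> 2) mpoly^2^2"
  show "generic_value ` (generic_matrix_ring_component \<alpha> :: (2, 2) generic_matrix_ring set) \<subseteq>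
      word_span ?G (\<alpha> 1) (\<alpha> 2)"
  proof (clarsimp simp: generic_matrix_ring_component_def generic_value.abs_eq)
    fix f :: "2 free_algebra" assume "f \<in> free_algebra_component \<alpha>"
    then have "w \<in> ?W" if "w \<in> Poly_Mapping.keys f" for w
      using that by (simp add: free_algebra_component_def count_list_eq_iff_2)
    then show "subst_matrices ?G f \<in> word_span ?G (\<alpha> 1) (\<alpha> 2)"
      unfolding subst_matrices_def matrix_scale_def[symmetric] word_span_def
      by (intro matrix.span_sum matrix.span_scale matrix.span_base imageI)
  qed
  show "word_span ?G (\<alpha> 1) (\<alpha> 2) \<subseteq>
      generic_value ` (generic_matrix_ring_component \<alpha> :: (2, 2) generic_matrix_ring set)"
  proof
    fix x assume "x \<in> word_span ?G (\<alpha> 1) (\<alpha> 2)"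
    then obtain c where x: "x = (\<Sum>w\<in>?W. matrix_scale (c w) (word_prod ?G w))"
      unfolding word_span_def using matrix.span_family_sum[OF finite_words] by blast
    define f :: "2 free_algebra" where "f = (\<Sum>w\<in>?W. Poly_Mapping.single w (c w))"
    have "Poly_Mapping.keys f \<subseteq> ?W"
    proof
      fix v assume "v \<in> Poly_Mapping.keys f"
      then have "(\<Sum>w\<in>?W. Poly_Mapping.lookup (Poly_Mapping.single w (c w)) v) \<noteq> 0"
        by (simp add: f_def in_keys_iff lookup_sum)
      then obtain w where "w \<in> ?W" "Poly_Mapping.lookup (Poly_Mapping.single w (c w)) v \<noteq> 0"
        using sum.neutral by (metis (mono_tags, lifting))
      then show "v \<in> ?W" by (auto simp: lookup_single when_def split: if_splits)
    qed
    then have "f \<in> free_algebra_component \<alpha>"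
      by (auto simp: free_algebra_component_def count_list_eq_iff_2)
    moreover have "subst_matrices ?G f = x"
    proof -
      have "subst_matrices ?G (\<Sum>w\<in>V. Poly_Mapping.single w (c w)) =
          (\<Sum>w\<in>V. matrix_scale (c w) (word_prod ?G w))" for V
        by (induction V rule: infinite_finite_induct)
          (simp_all add: subst_matrices_add subst_matrices_single matrix_scale_def)
      then show ?thesis by (simp add: f_def x)
    qed
    ultimately show "x \<in> generic_value ` (generic_matrix_ring_component \<alpha> :: (2, 2) generic_matrix_ring set)"
      unfolding generic_matrix_ring_component_def image_image generic_value.abs_eq by blast
  qed
qed

lemma dim_generic_matrix_ring_component:
  "generic_matrix_ring.dim (generic_matrix_ring_component \<alpha> :: (2, 2) generic_matrix_ring set) =
     card (basis_index (\<alpha> 1) (\<alpha> 2))"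
proof -
  let ?B = "basis_index (\<alpha> 1) (\<alpha> 2)"
  let ?R = "generic_matrix_ring_component \<alpha> :: (2, 2) generic_matrix_ring set"
  have image: "generic_value ` ?R = basis_span generic_matrix (\<alpha> 1) (\<alpha> 2)"
    using generic_value_component word_span_eq_basis_span by metis
  \<comment> \<open>The basis is lifted back through the embedding, inside the same graded
    component.\<close>
  have "\<forall>b\<in>?B. \<exists>r\<in>?R. generic_value r = basis_elem b generic_matrix"
    using basis_elem_in_basis_span image by (metis imageE)
  then obtain r where r: "\<And>b. b \<in> ?B \<Longrightarrow> r b \<in> ?R"
    "\<And>b. b \<in> ?B \<Longrightarrow> generic_value (r b) = basis_elem b generic_matrix"
    by metis
  have expand: "generic_value (\<Sum>b\<in>?B. generic_matrix_ring_scale (c b) (r b)) =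
      (\<Sum>b\<in>?B. matrix_scale (c b) (basis_elem b generic_matrix))" for c
    by (simp add: generic_value_sum generic_value_scale r)
  show ?thesis
  proof (rule generic_matrix_ring.dim_eq_card_family[OF finite_basis_index])
    show "\<forall>b\<in>?B. c b = 0" if "(\<Sum>b\<in>?B. generic_matrix_ring_scale (c b) (r b)) = 0" for c
      using expand[of c] that by (intro basis_elem_generic_independent finite_basis_index) simp
    show "r ` ?B \<subseteq> ?R" using r by blast
    show "?R \<subseteq> generic_matrix_ring.span (r ` ?B)"
    proof
      fix x assume "x \<in> ?R"
      then have "generic_value x \<in> basis_span generic_matrix (\<alpha> 1) (\<alpha> 2)"
        using image by blast
      then obtain c where
        "generic_value x = (\<Sum>b\<in>?B. matrix_scale (c b) (basis_elem b generic_matrix))"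
        unfolding basis_span_def using matrix.span_family_sum[OF finite_basis_index] by blast
      then have "x = (\<Sum>b\<in>?B. generic_matrix_ring_scale (c b) (r b))"
        by (simp add: expand[symmetric] generic_value_inject)
      then show "x \<in> generic_matrix_ring.span (r ` ?B)"
        by (simp add: generic_matrix_ring.span_sum generic_matrix_ring.span_scale
            generic_matrix_ring.span_base)
    qed
  qed
qed


section \<open>Counting the basis\<close>

definition total_index :: "nat \<Rightarrow> ((nat \<times> nat) + trace_index) set" where
  "total_index d = (\<Union>\<alpha>\<in>{\<alpha> :: 2 \<Rightarrow> nat. sum \<alpha> UNIV = d}. basis_index (\<alpha> 1) (\<alpha> 2))"

lemma finite_total_index: "finite (total_index d)"
  unfolding total_index_def using finite_multidegrees by (intro finite_UN_I finite_basis_index) auto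

lemma card_total_index:
  "card (total_index d) =
    (\<Sum>\<alpha> | sum \<alpha> (UNIV :: 2 set) = d. card (basis_index (\<alpha> 1) (\<alpha> 2)))"
  unfolding total_index_def
proof (rule card_UN_disjoint)
  show "\<forall>\<alpha>\<in>{\<alpha> :: 2 \<Rightarrow> nat. sum \<alpha> UNIV = d}. \<forall>\<beta>\<in>{\<alpha>. sum \<alpha> UNIV = d}. \<alpha> \<noteq> \<beta> \<longrightarrow>
      basis_index (\<alpha> 1) (\<alpha> 2) \<inter> basis_index (\<beta> 1) (\<beta> 2) = {}"
    by (auto simp: basis_index_def fun_eq_iff forall_2)
qed (simp_all add: finite_multidegrees finite_basis_index)

lemma total_index_eq:
  "total_index d = Inl ` {(p, q). p + q = d} \<union>
     Inr ` {t. Suc (Suc (trace_degree1 t + trace_degree2 t)) = d}"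
proof -
  have "\<exists>\<alpha> :: 2 \<Rightarrow> nat. \<alpha> 1 = p \<and> \<alpha> 2 = q" for p q
    by (rule exI[of _ "\<lambda>i. if i = 1 then p else q"]) simp
  then have "total_index d = (\<Union>(p, q)\<in>{(p, q). p + q = d}. basis_index p q)"
    unfolding total_index_def sum_2 by (auto, metis)
  also have "\<dots> = Inl ` {(p, q). p + q = d} \<union>
     Inr ` {t. Suc (Suc (trace_degree1 t + trace_degree2 t)) = d}"
  proof (rule set_eqI)
    fix b :: "(nat \<times> nat) + trace_index"
    show "b \<in> (\<Union>(p, q)\<in>{(p, q). p + q = d}. basis_index p q) \<longleftrightarrow>
        b \<in> Inl ` {(p, q). p + q = d} \<union>
          Inr ` {t. Suc (Suc (trace_degree1 t + trace_degree2 t)) = d}"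
    proof (cases b)
      case (Inr t)
      then have "b \<in> basis_index p q \<longleftrightarrow> Suc (trace_degree1 t) = p \<and> Suc (trace_degree2 t) = q" for p q
        by (auto simp: basis_index_def)
      with Inr show ?thesis by auto
    qed (auto simp: basis_index_def)
  qed
  finally show ?thesis .
qed

definition trace_total :: "nat \<Rightarrow> trace_index set" where
  "trace_total n = {t. trace_degree1 t + trace_degree2 t = n}"

lemma finite_trace_total: "finite (trace_total n)"
  unfolding trace_total_def
  by (rule finite_subset[of _ "{..n} \<times> {..n} \<times> {..n} \<times> {..n} \<times> {..n}"]) auto

text \<open>Stars and bars. The grouping of the sum is the total degree of a trace index with
  \<open>m = 0\<close>.\<close>

lemma card_quadruples: "card {(i, j, k, l :: nat). i + k + (j + l) = n} = (n + 3 choose 3)"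
proof -
  have "bij_betw (\<lambda>(i, j, k, l). [i, j, k, l]) {(i, j, k, l). i + k + (j + l) = n}
      {xs. length xs = 4 \<and> sum_list xs = n}"
    by (rule bij_betwI[where g = "\<lambda>xs. (xs ! 0, xs ! 1, xs ! 2, xs ! 3)"])
      (auto simp: numeral_eq_Suc length_Suc_conv)
  then have "card {(i, j, k, l :: nat). i + k + (j + l) = n} =
      card {xs. length xs = 4 \<and> sum_list xs = n}"
    by (rule bij_betw_same_card)
  also have "\<dots> = (n + 3 choose n)" by (simp add: card_length_sum_list add.commute)
  also have "\<dots> = (n + 3 choose 3)" using binomial_symmetric[of n "n + 3"] by simp
  finally show ?thesis .
qed

text \<open>The mixed trace has total degree two: indices with positive \<open>m\<close> come from
  degree \<open>n\<close> by raising \<open>m\<close>, and those with \<open>m = 0\<close> are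
  quadruples.\<close>

lemma card_trace_total_Suc_Suc:
  "card (trace_total (Suc (Suc n))) = card (trace_total n) + (n + 5 choose 3)"
proof -
  let ?M = "(\<lambda>(m, t). (Suc m, t)) ` trace_total n"
  let ?Z = "Pair 0 ` {(i, j, k, l). i + k + (j + l) = Suc (Suc n)} :: trace_index set"
  have eq: "trace_total (Suc (Suc n)) = ?M \<union> ?Z"
  proof (rule set_eqI)
    fix t :: trace_index
    obtain m i j k l where t: "t = (m, i, j, k, l)" by (cases t)
    show "t \<in> trace_total (Suc (Suc n)) \<longleftrightarrow> t \<in> ?M \<union> ?Z"
      by (cases m) (auto simp: t trace_total_def image_iff)
  qed
  have "card ?M = card (trace_total n)"
    by (rule card_image) (auto simp: inj_on_def)
  moreover have "card ?Z = (n + 5 choose 3)"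
    using card_quadruples[of "Suc (Suc n)"] by (subst card_image) (auto simp: inj_on_def eval_nat_numeral)
  moreover have "finite ?M" "finite ?Z"
    using finite_trace_total[of "Suc (Suc n)"] unfolding eq by simp_all
  moreover have "?M \<inter> ?Z = {}" by auto
  ultimately show ?thesis unfolding eq by (simp add: card_Un_disjoint)
qed

lemma choose_3: "6 * (n + 3 choose 3) = (n + 1) * (n + 2) * (n + 3)"
proof -
  have "3 * (n + 3 choose 3) = (n + 3) * (n + 2 choose 2)"
    using Suc_times_binomial_eq[of "n + 2" 2] by (simp add: eval_nat_numeral)
  moreover have "2 * (n + 2 choose 2) = (n + 2) * (n + 1)"
    using Suc_times_binomial_eq[of "n + 1" 1] by (simp add: eval_nat_numeral)
  ultimately show ?thesis by algebra
qed

lemma card_trace_total_less_2: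
  assumes "n < 2"
  shows "card (trace_total n) = (n + 3 choose 3)"
proof -
  have "trace_total n = Pair 0 ` {(i, j, k, l). i + k + (j + l) = n}"
  proof (rule set_eqI)
    fix t :: trace_index
    obtain m i j k l where "t = (m, i, j, k, l)" by (cases t)
    then show "t \<in> trace_total n \<longleftrightarrow> t \<in> Pair 0 ` {(i, j, k, l). i + k + (j + l) = n}"
      using assms by (cases m) (auto simp: trace_total_def image_iff)
  qed
  then show ?thesis by (simp add: card_image inj_on_def card_quadruples)
qed

text \<open>The recursion has step two and keeps the parity of \<open>n\<close>. Clearing the
  denominator 48 and adding the odd correction on the left avoid division and subtraction of natural
  numbers.\<close>

lemma card_trace_total:
  "48 * card (trace_total n) + (if even n then 0 else 3) =
     n ^ 4 + 12 * n ^ 3 + 50 * n\<^sup>2 + 84 * n + 48"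
proof (induction n rule: induct_nat_012)
  case (ge2 n)
  have "n + 2 + 3 = n + 5" "n + 2 + 1 = n + 3" "n + 2 + 2 = n + 4" by simp_all
  with choose_3[of "n + 2"] have "6 * (n + 5 choose 3) = (n + 3) * (n + 4) * (n + 5)" by metis
  then have "48 * (n + 5 choose 3) = 8 * ((n + 3) * (n + 4) * (n + 5))" by linarith
  then have "48 * card (trace_total (Suc (Suc n))) + (if even (Suc (Suc n)) then 0 else 3) =
      n ^ 4 + 12 * n ^ 3 + 50 * n\<^sup>2 + 84 * n + 48 + 8 * ((n + 3) * (n + 4) * (n + 5))"
    using ge2.IH(1) unfolding card_trace_total_Suc_Suc even_Suc not_not distrib_left by linarith
  also have "\<dots> = (n + 2) ^ 4 + 12 * (n + 2) ^ 3 + 50 * (n + 2)\<^sup>2 + 84 * (n + 2) + 48"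
    by algebra
  finally show ?case by simp
qed (use choose_3[of 0] choose_3[of 1] in \<open>simp_all add: card_trace_total_less_2\<close>)

lemma card_pairs: "card {(p, q :: nat). p + q = d} = Suc d"
proof -
  have "{(p, q). p + q = d} = (\<lambda>p. (p, d - p)) ` {..d}" by force
  then show ?thesis by (simp add: card_image inj_on_def)
qed

text \<open>There are \<open>d + 1\<close> ordered words, and the commutator uses up degree two. The
  case \<open>d < 2\<close> is separate because the truncated \<open>d - 2\<close> would wrongly
  give \<open>trace_total 0\<close>.\<close>

lemma card_total_index_split:
  "card (total_index d) = Suc d + (if d < 2 then 0 else card (trace_total (d - 2)))"
proof -
  let ?T = "{t. Suc (Suc (trace_degree1 t + trace_degree2 t)) = d}"
  have T: "?T = (if d < 2 then {} else trace_total (d - 2))"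
    by (auto simp: trace_total_def)
  have "card (total_index d) =
      card (Inl ` {(p, q). p + q = d} :: ((nat \<times> nat) + trace_index) set) +
      card (Inr ` ?T :: ((nat \<times> nat) + trace_index) set)"
    unfolding total_index_eq
    by (rule card_Un_disjoint) (use finite_total_index[of d] in \<open>auto simp: total_index_eq\<close>)
  then show ?thesis by (simp add: card_image card_pairs T)
qed

lemma card_total_index_formula:
  "48 * card (total_index d) + (if even d then 0 else 3) =
     d ^ 4 + 4 * d ^ 3 + 2 * d\<^sup>2 + 44 * d + 48"
proof (cases "d < 2")
  case True
  then have "d = 0 \<or> d = 1" by auto
  then show ?thesis by (auto simp: card_total_index_split)
next
  case False
  then obtain n where d: "d = n + 2" by (metis add.commute le_Suc_ex not_less)
  have "48 * card (total_index d) + (if even d then 0 else 3) =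
      48 * (n + 3) + (48 * card (trace_total n) + (if even n then 0 else 3))"
    by (simp add: d card_total_index_split)
  also have "\<dots> = 48 * (n + 3) + (n ^ 4 + 12 * n ^ 3 + 50 * n\<^sup>2 + 84 * n + 48)"
    by (simp only: card_trace_total)
  also have "\<dots> = d ^ 4 + 4 * d ^ 3 + 2 * d\<^sup>2 + 44 * d + 48"
    unfolding d by algebra
  finally show ?thesis .
qed

text \<open>Rounding down absorbs the correction 3, which gives a form suited to numerical
  evaluation.\<close>

lemma card_total_index_div:
  "card (total_index d) = (d ^ 4 + 4 * d ^ 3 + 2 * d\<^sup>2 + 44 * d + 48) div 48"
  unfolding card_total_index_formula[symmetric] by simp

lemma of_nat_card_total_index:
  "rat_of_nat (card (total_index d)) =
     (of_nat d ^ 4 + 4 * of_nat d ^ 3 + 2 * of_nat d ^ 2 + 44 * of_nat d + (if even d then 48 else 45)) / 48"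
  using arg_cong[OF card_total_index_formula[of d], of rat_of_nat] by (simp split: if_splits)


section \<open>The span of the homogeneous matrix product states\<close>

lemma trace_mult_sum:
  fixes X :: "complex^'m^'m"
  shows "trace (X ** (\<Sum>b\<in>B. mat (c b) ** M b)) = (\<Sum>b\<in>B. c b * trace (X ** M b))"
proof -
  have "trace (\<Sum>b\<in>B. N b) = (\<Sum>b\<in>B. trace (N b))" for N :: "_ \<Rightarrow> complex^'m^'m"
    by (induction B rule: infinite_finite_induct) (simp_all add: trace_add, simp_all add: trace_def)
  moreover have "trace (mat a ** N) = a * trace N" for a and N :: "complex^'m^'m"
    by (simp add: mat_matrix_mult trace_def sum_distrib_left)
  ultimately show ?thesis by (simp add: matrix_mult_sum_right mult_mat_assoc[of X])
qed

lemma trace_form_nondegenerate: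
  fixes M :: "complex^2^2"
  assumes "\<And>X. trace (X ** M) = 0"
  shows "M = 0"
proof -
  have "M $ a $ b = 0" for a b
    \<comment> \<open>The trace against the matrix unit at position \<open>(b, a)\<close> is the
      entry of \<open>M\<close> at \<open>(a, b)\<close>.\<close>
    using assms[of "\<chi> i j. if i = b \<and> j = a then 1 else 0"] exhaust_2[of a] exhaust_2[of b]
    by (auto simp: matrix2_simps)
  then show ?thesis by (simp add: vec_eq_iff)
qed

lemma dim_span_hMPS_2_2: "dim_span_hMPS TYPE(2) TYPE(2) d = card (total_index d)"
proof -
  let ?G = "generic_matrix :: 2 \<Rightarrow> (2 \<times> 2 \<times> 2) mpoly^2^2"
  let ?I = "total_index d" and ?W = "{w :: 2 list. length w = d}"
  have W: "finite ?W" using finite_lists_length_eq[of "UNIV :: 2 set" d] by simp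
  \<comment> \<open>Expanding at generic matrices makes the coefficients independent of the point
    \<open>(X, A)\<close>.\<close>
  have "\<forall>w\<in>?W. \<exists>c. word_prod ?G w = (\<Sum>b\<in>?I. matrix_scale (c b) (basis_elem b ?G))"
  proof (intro ballI matrix.span_family_sum[OF finite_total_index])
    fix w :: "2 list" assume "w \<in> ?W"
    then have "basis_index (count_list w 1) (count_list w 2) \<subseteq> ?I"
      unfolding total_index_def by (intro UN_upper) (simp add: sum_2 length_eq_counts_2)
    then show "word_prod ?G w \<in> matrix.span ((\<lambda>b. basis_elem b ?G) ` ?I)"
      using word_prod_in_basis_span[of ?G w] unfolding basis_span_def
      by (meson image_mono matrix.span_mono subsetD)
  qed
  from bchoice[OF this] obtain c where c: "\<And>w. length w = d \<Longrightarrow>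
      word_prod ?G w = (\<Sum>b\<in>?I. matrix_scale (c w b) (basis_elem b ?G))" by blast
  have "\<forall>b\<in>?I. \<exists>e. basis_elem b ?G = (\<Sum>w\<in>?W. matrix_scale (e w) (word_prod ?G w))"
  proof (intro ballI matrix.span_family_sum[OF W])
    fix b assume "b \<in> ?I"
    then obtain p q where pq: "p + q = d" "b \<in> basis_index p q"
      by (auto simp: total_index_def sum_2)
    have "{w. count_list w 1 = p \<and> count_list w 2 = q} \<subseteq> ?W"
      using pq(1) by (auto simp: length_eq_counts_2)
    then show "basis_elem b ?G \<in> matrix.span (word_prod ?G ` ?W)"
      using basis_elem_in_word_span[OF pq(2), of ?G] unfolding word_span_def
      by (meson image_mono matrix.span_mono subsetD)
  qed
  from bchoice[OF this] obtain e where e: "\<And>b. b \<in> ?I \<Longrightarrow>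
      basis_elem b ?G = (\<Sum>w\<in>?W. matrix_scale (e b w) (word_prod ?G w))" by blast
  define f :: "(complex^2^2) \<times> (2 \<Rightarrow> complex^2^2) \<Rightarrow> 2 list \<Rightarrow> complex" where
    "f = (\<lambda>(X, A). hmps_map d X A)"
  define g :: "(nat \<times> nat) + trace_index \<Rightarrow> (complex^2^2) \<times> (2 \<Rightarrow> complex^2^2) \<Rightarrow> complex" where
    "g b = (\<lambda>(X, A). trace (X ** basis_elem b A))" for b
  have "hMPS TYPE(2) TYPE(2) d = zariski_closure (tensor_space d) (range f)"
    unfolding hMPS_def f_def by (rule arg_cong[where f = "zariski_closure (tensor_space d)"]) auto
  moreover have "tensor.dim (tensor.span (zariski_closure (tensor_space d) (range f))) = card ?I"
  proof (rule dim_span_zariski_closure[OF finite_total_index])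
    fix p :: "(complex^2^2) \<times> (2 \<Rightarrow> complex^2^2)"
    obtain X A where p: "p = (X, A)" by (cases p)
    let ?ev = "eval_matrix (\<lambda>(i, j, k). A i $ j $ k)"
    note ev = eval_matrix_sum eval_matrix_scale eval_matrix_basis_elem eval_matrix_word_prod
      eval_generic_matrix
    show "f p w = (\<Sum>b\<in>?I. c w b * g b p)" if "length w = d" for w
      using arg_cong[OF c[OF that], of ?ev] that
      by (simp add: f_def g_def p hmps_map_def ev trace_mult_sum)
    show "f p \<in> tensor_space d"
      by (simp add: f_def p hmps_map_in_tensor_space)
    show "g b p = (\<Sum>w\<in>?W. e b w * f p w)" if "b \<in> ?I" for b
      using arg_cong[OF e[OF that], of ?ev] W
      by (simp add: f_def g_def p hmps_map_def ev trace_mult_sum)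
  next
    fix a assume a: "\<And>p. (\<Sum>b\<in>?I. a b * g b p) = 0"
    show "\<forall>b\<in>?I. a b = 0"
    proof (rule basis_elem_independent[OF finite_total_index])
      fix A :: "2 \<Rightarrow> complex^2^2"
      show "(\<Sum>b\<in>?I. mat (a b) ** basis_elem b A) = 0"
      \<comment> \<open>Since \<open>X\<close> is arbitrary and the trace form is nondegenerate,
        pairing with \<open>X\<close> loses no information about the basis.\<close>
      proof (rule trace_form_nondegenerate)
        fix X show "trace (X ** (\<Sum>b\<in>?I. mat (a b) ** basis_elem b A)) = 0"
          using a[of "(X, A)"] by (simp add: trace_mult_sum g_def)
      qed
    qed
  qed
  ultimately show ?thesis by (simp add: dim_span_hMPS_def)
qed


section \<open>Hilbert series\<close>

lemma hilbert_series_2_2_nth: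
  "fps_nth (fps_diagonal (generic_matrix_ring_hilbert_series TYPE(2) TYPE(2))) d =
     rat_of_nat (card (total_index d))"
  by (simp add: fps_diagonal_def generic_matrix_ring_hilbert_series_def
      dim_generic_matrix_ring_component card_total_index)

text \<open>After multiplication by the denominator, coefficients are compared: the first six
  numerically, the others as a linear recurrence satisfied by the closed formula in each
  parity.\<close>

lemma fps_card_total_index:
  "Abs_fps (\<lambda>d. rat_of_nat (card (total_index d))) =
     (1 - 2 * fps_X + fps_X ^ 2 + 2 * fps_X ^ 3 - fps_X ^ 4) /
     ((1 - fps_X) ^ 4 * (1 - fps_X ^ 2))" (is "?F = ?num / ?den")
proof -
  \<comment> \<open>The exponent 1 is kept visible so that every term is treated by the same rule
    for shifted coefficients.\<close>
  have den: "?den = 1 - fps_const 4 * fps_X ^ 1 + fps_const 5 * fps_X ^ 2 - fps_const 5 * fps_X ^ 4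
      + fps_const 4 * fps_X ^ 5 - fps_X ^ 6"
    unfolding numeral_fps_const[symmetric] by algebra
  have num: "?num = 1 - fps_const 2 * fps_X ^ 1 + fps_X ^ 2 + fps_const 2 * fps_X ^ 3 - fps_X ^ 4"
    by (simp add: numeral_fps_const)
  have expand: "?F * ?den = ?F - fps_const 4 * (?F * fps_X ^ 1) + fps_const 5 * (?F * fps_X ^ 2)
      - fps_const 5 * (?F * fps_X ^ 4) + fps_const 4 * (?F * fps_X ^ 5) - ?F * fps_X ^ 6"
    unfolding den by (simp only: algebra_simps mult_1_left)
  have "fps_nth (?F * ?den) n = fps_nth ?num n" for n
  \<comment> \<open>Six is the degree of the denominator: from there on all shifted indices are
    natural numbers, and the numerator, of degree four, contributes nothing.\<close>
  proof (cases "n < 6")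
    case True
    then have "n \<in> {0, 1, 2, 3, 4, 5}" by auto
    then show ?thesis
      unfolding expand num
      by (auto simp: fps_X_power_mult_right_nth fps_X_power_nth card_total_index_div
          simp del: power_one_right)
  next
    case False
    then obtain m where n: "n = m + 6" by (metis add.commute le_Suc_ex not_less)
    show ?thesis
      unfolding expand num n
      by (cases "even m") (simp_all add: fps_X_power_mult_right_nth fps_X_power_nth
          of_nat_card_total_index del: power_one_right,
        simp_all add: field_simps eval_nat_numeral)
  qed
  then have eq: "?F * ?den = ?num" by (rule fps_ext)
  have "?den \<noteq> 0"
    using arg_cong[of ?den 0 "\<lambda>f. fps_nth f 0"] by (auto simp: den)
  then have "?F = ?F * ?den / ?den" by (rule nonzero_mult_div_cancel_right[symmetric])
  then show ?thesis unfolding eq .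
qed

theorem mainTheorem2:
  shows "Abs_fps (\<lambda>d. rat_of_nat (dim_span_hMPS TYPE(2) TYPE(2) d)) =
           fps_diagonal (generic_matrix_ring_hilbert_series TYPE(2) TYPE(2))
       \<and> fps_diagonal (generic_matrix_ring_hilbert_series TYPE(2) TYPE(2)) =
           (1 - 2 * fps_X + fps_X ^ 2 + 2 * fps_X ^ 3 - fps_X ^ 4) /
           ((1 - fps_X) ^ 4 * (1 - fps_X ^ 2))
       \<and> map (dim_span_hMPS TYPE(2) TYPE(2)) [0..<16] =
           [1, 2, 4, 8, 16, 30, 53, 88, 139, 210, 306, 432, 594, 798, 1051, 1360]
       \<and> (\<forall>d. rat_of_nat (dim_span_hMPS TYPE(2) TYPE(2) d) =
             (if even d
              then 1 / 48 * (of_nat d ^ 4 + 4 * of_nat d ^ 3 + 2 * of_nat d ^ 2 + 44 * of_nat d + 48)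
              else 1 / 48 * (of_nat d ^ 4 + 4 * of_nat d ^ 3 + 2 * of_nat d ^ 2 + 44 * of_nat d + 45)))"
proof (intro conjI allI)
  have hilbert: "fps_diagonal (generic_matrix_ring_hilbert_series TYPE(2) TYPE(2)) =
      Abs_fps (\<lambda>d. rat_of_nat (card (total_index d)))"
    by (rule fps_ext) (simp add: hilbert_series_2_2_nth)
  then show "Abs_fps (\<lambda>d. rat_of_nat (dim_span_hMPS TYPE(2) TYPE(2) d)) =
      fps_diagonal (generic_matrix_ring_hilbert_series TYPE(2) TYPE(2))"
    by (simp add: dim_span_hMPS_2_2)
  show "fps_diagonal (generic_matrix_ring_hilbert_series TYPE(2) TYPE(2)) =
      (1 - 2 * fps_X + fps_X ^ 2 + 2 * fps_X ^ 3 - fps_X ^ 4) /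
      ((1 - fps_X) ^ 4 * (1 - fps_X ^ 2))"
    unfolding hilbert by (rule fps_card_total_index)
  show "map (dim_span_hMPS TYPE(2) TYPE(2)) [0..<16] =
      [1, 2, 4, 8, 16, 30, 53, 88, 139, 210, 306, 432, 594, 798, 1051, 1360]"
  proof -
    have "[0..<16] = [0, 1, 2, 3, 4, 5, 6, 7, 8, 9, 10, 11, 12, 13, 14, 15]"
      by (simp add: upt_rec_numeral upt_conv_Cons eval_nat_numeral)
    then show ?thesis by (simp add: dim_span_hMPS_2_2 card_total_index_div)
  qed
  show "rat_of_nat (dim_span_hMPS TYPE(2) TYPE(2) d) =
      (if even d
       then 1 / 48 * (of_nat d ^ 4 + 4 * of_nat d ^ 3 + 2 * of_nat d ^ 2 + 44 * of_nat d + 48)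
       else 1 / 48 * (of_nat d ^ 4 + 4 * of_nat d ^ 3 + 2 * of_nat d ^ 2 + 44 * of_nat d + 45))" for d
    by (simp add: dim_span_hMPS_2_2 of_nat_card_total_index)
qed

end
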